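(* Let $P\equiv(P,G,B,\pi)$ and $Q\equiv(Q,H,B,\pi')$ be smooth (Banach) principal bundles over the same base $B$, trivialized over a common open cover $\{U_\alpha\}_{\alpha\in I}$ of $B$, with natural local sections $\{s_\alpha\}_{\alpha\in I}$ of $P$ and $\{t_\alpha\}_{\alpha\in I}$ of $Q$. Let $(f,\varphi,\mathrm{id}_B)$ be a principal bundle morphism of $P$ into $Q$. Let $\omega$ and $\theta$ be connections on $P$ and $Q$, respectively, with local connection forms $\omega_\alpha=s_\alpha^*\omega$ and $\theta_\alpha=t_\alpha^*\theta$ ($\alpha\in I$). Let $\{h_\alpha\colon U_\alpha\to H\mid\alpha\in I\}$ be the smooth maps satisfying $$f\circ s_\alpha=t_\alpha\cdot h_\alpha,\qquad \alpha\in I.$$ Then $\omega$ and $\theta$ are $(f,\varphi,\mathrm{id}_B)$-related if and only if $$\overline{\varphi}\,\omega_\alpha=\mathrm{Ad}(h_\alpha^{-1}).\theta_\alpha+h_\alpha^{-1}dh_\alpha\qquad\text{for every }\alpha\in I.$$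
   Context: All manifolds and bundles are modelled on Banach spaces and are smooth ($C^\infty$); Lie groups are Banach–Lie groups. In a principal bundle $(P,G,B,\pi)$ the structure group $G$ acts on the total space $P$ on the right; $R_g\colon P\to P$, $R_g(p)=pg$. $\mathfrak{g}=T_eG$ and $\mathfrak{h}=T_eH$ are the Lie algebras of $G$ and $H$. A principal bundle morphism $(f,\varphi,\mathrm{id}_B)\colon (P,G,B,\pi)\to(Q,H,B,\pi')$ consists of a smooth map $f\colon P\to Q$ and a morphism of (Banach–)Lie groups $\varphi\colon G\to H$ with $\pi'\circ f=\pi$ and $f(pg)=f(p)\varphi(g)$ for all $p\in P$, $g\in G$. $\overline{\varphi}=T_e\varphi\colon\mathfrak{g}\to\mathfrak{h}$ is the induced Lie algebra morphism. A connection on $P$ is (equivalently) given by a connection form: a smooth $\mathfrak{g}$-valued 1-form $\omega$ on $P$ with $\omega(X^* )=X$ for all $X\in\mathfrak{g}$, where $X^*$ is the fundamental vector field, $X^*_p=T_e(g\mapsto pg)(X)$, and $R_g^*\omega=\mathrm{Ad}(g^{-1}).\omega$ for all $g\in G$. Connections $\omega$ on $P$ and $\theta$ on $Q$ are $(f,\varphi,\mathrm{id}_B)$-related if $f^*\theta=\overline{\varphi}\omega$, i.e. $\theta_{f(p)}(T_pf(u))=\overline{\varphi}(\omega_p(u))$ for all $p\in P$, $u\in T_pP$. Given $G$-equivariant local trivializations $\Phi_\alpha\colon\pi^{-1}(U_\alpha)\to U_\alpha\times G$ of $P$, the natural local sections are $s_\alpha(x)=\Phi_\alpha^{-1}(x,e)$;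 similarly $t_\alpha$ for $Q$. The local connection forms are $\omega_\alpha=s_\alpha^*\omega$, a $\mathfrak{g}$-valued 1-form on $U_\alpha$. For a smooth map $h\colon U\to H$ ($U\subseteq B$ open), $h^{-1}dh$ is the left Maurer–Cartan (logarithmic) differential, the $\mathfrak{h}$-valued 1-form on $U$ given by $(h^{-1}dh)_x(v)=(T_{h(x)}\lambda_{h(x)^{-1}}\circ T_xh)(v)$, where $\lambda_a$ is left translation by $a\in H$. $\mathrm{Ad}(h^{-1}).\theta$ denotes the form $x\mapsto \mathrm{Ad}(h(x)^{-1})\circ\theta_x$. *)

theory Defs
  imports
    "HOL-Analysis.Analysis"
    "HOL-Algebra.Group"
    "HOL-Library.Function_Algebras"
begin

section \<open>Smooth maps between Banach spaces\<close>

text \<open>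
  Bounded \<open>n\<close>-linear maps are represented as functions on lists of vectors, of which only the
  values on lists of length \<open>n\<close> matter. In this way the spaces of \<open>n\<close>-linear maps for all \<open>n\<close> live
  in a single type.
\<close>

definition bounded_multilinear ::
    "nat \<Rightarrow> ('a::real_normed_vector list \<Rightarrow> 'b::real_normed_vector) \<Rightarrow> bool" where
  "bounded_multilinear n m \<longleftrightarrow>
     (\<forall>us ws. Suc (length us + length ws) = n \<longrightarrow> linear (\<lambda>v. m (us @ v # ws))) \<and>
     (\<exists>K. \<forall>vs. length vs = n \<longrightarrow> norm (m vs) \<le> K * prod_list (map norm vs))"

text \<open>
  \<open>D n x\<close> is the \<open>n\<close>-th derivative of \<open>f\<close> at \<open>x\<close>. The last clause says that \<open>D n\<close> is Frechet
  differentiable with derivative \<open>D (Suc n)\<close>, with respect to the operator norm on bounded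
  \<open>n\<close>-linear maps: the operator norm of \<open>D n y - D n x - D (Suc n) x (y - x)\<close> is at most
  \<open>e * norm (y - x)\<close> for \<open>y\<close> close to \<open>x\<close>.
\<close>

definition smooth_on ::
    "'a::real_normed_vector set \<Rightarrow> ('a \<Rightarrow> 'b::real_normed_vector) \<Rightarrow> bool" where
  "smooth_on S f \<longleftrightarrow> open S \<and>
     (\<exists>D :: nat \<Rightarrow> 'a \<Rightarrow> 'a list \<Rightarrow> 'b.
        (\<forall>x\<in>S. D 0 x [] = f x) \<and>
        (\<forall>n. \<forall>x\<in>S. bounded_multilinear n (D n x)) \<and>
        (\<forall>n. \<forall>x\<in>S. \<forall>e>0. \<exists>d>0. \<forall>y\<in>S. norm (y - x) < d \<longrightarrow>
           (\<forall>vs. length vs = n \<longrightarrow>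
              norm (D n y vs - D n x vs - D (Suc n) x ((y - x) # vs))
                \<le> e * norm (y - x) * prod_list (map norm vs))))"


section \<open>Banach manifolds\<close>

text \<open>
  A manifold is given by an atlas; its points are those covered by the charts, and its topology is
  the one determined by the charts. A chart is a domain with a coordinate map, whose values
  outside the domain are irrelevant. The Hausdorff property is not required.
\<close>

type_synonym ('a, 'e) chart = "'a set \<times> ('a \<Rightarrow> 'e)"
type_synonym ('a, 'e) atlas = "('a, 'e) chart set"

definition points :: "('a, 'e) atlas \<Rightarrow> 'a set" where
  "points M = (\<Union>c\<in>M. fst c)"

definition charts_at :: "('a, 'e) atlas \<Rightarrow> 'a \<Rightarrow> ('a, 'e) chart set" where
  "charts_at M p = {c \<in> M. p \<in> fst c}"

definition chart_inv :: "('a, 'e) chart \<Rightarrow> 'e \<Rightarrow> 'a" where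
  "chart_inv c = inv_into (fst c) (snd c)"

definition local_rep ::
    "('a, 'e) chart \<Rightarrow> ('b, 'f) chart \<Rightarrow> ('a \<Rightarrow> 'b) \<Rightarrow> 'e \<Rightarrow> 'f" where
  "local_rep c k f = snd k \<circ> f \<circ> chart_inv c"

abbreviation transition :: "('a, 'e) chart \<Rightarrow> ('a, 'e) chart \<Rightarrow> 'e \<Rightarrow> 'e" where
  "transition c k \<equiv> local_rep c k id"

definition banach_manifold :: "('a, 'e::banach) atlas \<Rightarrow> bool" where
  "banach_manifold M \<longleftrightarrow>
     (\<forall>c\<in>M. inj_on (snd c) (fst c) \<and> open (snd c ` fst c)) \<and>
     (\<forall>c\<in>M. \<forall>k\<in>M. smooth_on (snd c ` (fst c \<inter> fst k)) (transition c k))"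

definition manifold_open :: "('a, 'e::banach) atlas \<Rightarrow> 'a set \<Rightarrow> bool" where
  "manifold_open M W \<longleftrightarrow> W \<subseteq> points M \<and> (\<forall>c\<in>M. open (snd c ` (fst c \<inter> W)))"

text \<open>
  Smoothness of a map from the open subset \<open>W\<close> of \<open>M\<close> into \<open>N\<close>. Continuity is part of the
  definition, because \<^const>\<open>smooth_on\<close> requires an open domain.
\<close>

definition smooth_map_on ::
    "('a, 'e::banach) atlas \<Rightarrow> 'a set \<Rightarrow> ('b, 'f::banach) atlas \<Rightarrow> ('a \<Rightarrow> 'b) \<Rightarrow> bool" where
  "smooth_map_on M W N f \<longleftrightarrow>
     manifold_open M W \<and> f ` W \<subseteq> points N \<and>
     (\<forall>c\<in>M. \<forall>k\<in>N. smooth_on (snd c ` (fst c \<inter> W \<inter> f -` fst k)) (local_rep c k f))"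

definition prod_atlas :: "('a, 'e) atlas \<Rightarrow> ('b, 'f) atlas \<Rightarrow> ('a \<times> 'b, 'e \<times> 'f) atlas" where
  "prod_atlas M N =
     (\<lambda>(c, k). (fst c \<times> fst k, map_prod (snd c) (snd k))) ` (M \<times> N)"


section \<open>Tangent spaces and tangent maps\<close>

text \<open>
  A tangent vector at \<open>p\<close> is represented by the family of its components in all charts around \<open>p\<close>,
  extended by \<open>0\<close> to the other charts. Addition of tangent vectors at the same point is thus
  pointwise addition of functions.
\<close>

type_synonym ('a, 'e) tangent = "('a, 'e) chart \<Rightarrow> 'e"

definition tangent_space ::
    "('a, 'e::banach) atlas \<Rightarrow> 'a \<Rightarrow> ('a, 'e) tangent set" where
  "tangent_space M p =
     {u. (\<forall>c\<in>charts_at M p. \<forall>k\<in>charts_at M p.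
            u k = frechet_derivative (transition c k) (at (snd c p)) (u c)) \<and>
         (\<forall>c. c \<notin> charts_at M p \<longrightarrow> u c = 0)}"

text \<open>The tangent vector at \<open>p\<close> with component \<open>v\<close> in the chart \<open>c\<close>:\<close>

definition chart_tangent ::
    "('a, 'e::banach) atlas \<Rightarrow> ('a, 'e) chart \<Rightarrow> 'a \<Rightarrow> 'e \<Rightarrow> ('a, 'e) tangent" where
  "chart_tangent M c p v =
     (\<lambda>k. if k \<in> charts_at M p
          then frechet_derivative (transition c k) (at (snd c p)) v else 0)"

text \<open>
  The tangent map \<open>T\<^sub>p f\<close>. It depends only on \<open>f\<close> near \<open>p\<close>, so it also serves for
  maps on an open subset \<open>W\<close> of \<open>M\<close>, whose tangent spaces are identified with those of \<open>M\<close>. By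
  the chain rule the choice of the chart \<open>c\<close> is immaterial.
\<close>

definition tangent_map ::
    "('a, 'e::banach) atlas \<Rightarrow> ('b, 'f::banach) atlas \<Rightarrow> ('a \<Rightarrow> 'b) \<Rightarrow> 'a
       \<Rightarrow> ('a, 'e) tangent \<Rightarrow> ('b, 'f) tangent" where
  "tangent_map M N f p u =
     (\<lambda>k. if k \<in> charts_at N (f p)
          then let c = (SOME c. c \<in> charts_at M p)
               in frechet_derivative (local_rep c k f) (at (snd c p)) (u c)
          else 0)"


section \<open>Banach--Lie groups\<close>

record ('g, 'e) charted_group = "'g monoid" +
  group_atlas :: "('g, 'e) atlas"

locale banach_lie_group = group G for G :: "('g, 'e::banach) charted_group" (structure) +
  assumes manifold: "banach_manifold (group_atlas G)"
    and points_carrier: "points (group_atlas G) = carrier G"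
    and smooth_mult:
      "smooth_map_on (prod_atlas (group_atlas G) (group_atlas G)) (carrier G \<times> carrier G)
         (group_atlas G) (\<lambda>(a, b). a \<otimes> b)"
    and smooth_inv: "smooth_map_on (group_atlas G) (carrier G) (group_atlas G) (\<lambda>a. inv a)"

definition lie_group_hom ::
    "('g, 'e::banach) charted_group \<Rightarrow> ('h, 'f::banach) charted_group \<Rightarrow> ('g \<Rightarrow> 'h) \<Rightarrow> bool" where
  "lie_group_hom G H \<phi> \<longleftrightarrow>
     \<phi> \<in> hom G H \<and> smooth_map_on (group_atlas G) (carrier G) (group_atlas H) \<phi>"

definition lie_algebra :: "('g, 'e::banach) charted_group \<Rightarrow> ('g, 'e) tangent set" where
  "lie_algebra G = tangent_space (group_atlas G) \<one>\<^bsub>G\<^esub>"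

definition lie_algebra_map ::
    "('g, 'e::banach) charted_group \<Rightarrow> ('h, 'f::banach) charted_group \<Rightarrow> ('g \<Rightarrow> 'h)
       \<Rightarrow> ('g, 'e) tangent \<Rightarrow> ('h, 'f) tangent" where
  "lie_algebra_map G H \<phi> = tangent_map (group_atlas G) (group_atlas H) \<phi> \<one>\<^bsub>G\<^esub>"

definition Ad ::
    "('g, 'e::banach) charted_group \<Rightarrow> 'g \<Rightarrow> ('g, 'e) tangent \<Rightarrow> ('g, 'e) tangent" where
  "Ad G g = lie_algebra_map G G (\<lambda>a. g \<otimes>\<^bsub>G\<^esub> a \<otimes>\<^bsub>G\<^esub> inv\<^bsub>G\<^esub> g)"

text \<open>The left logarithmic differential \<open>h\<inverse> dh\<close> of a map \<open>h\<close> from an open subset of \<open>M\<close> to \<open>H\<close>:\<close>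

definition log_differential ::
    "('a, 'e::banach) atlas \<Rightarrow> ('h, 'f::banach) charted_group \<Rightarrow> ('a \<Rightarrow> 'h)
       \<Rightarrow> 'a \<Rightarrow> ('a, 'e) tangent \<Rightarrow> ('h, 'f) tangent" where
  "log_differential M H h x v =
     tangent_map (group_atlas H) (group_atlas H) (\<lambda>b. inv\<^bsub>H\<^esub> (h x) \<otimes>\<^bsub>H\<^esub> b) (h x)
       (tangent_map M (group_atlas H) h x v)"


section \<open>Principal bundles\<close>

definition local_trivialization ::
    "('p, 'ep::banach) atlas \<Rightarrow> ('p \<Rightarrow> 'g \<Rightarrow> 'p) \<Rightarrow> ('g, 'eg::banach) charted_group
       \<Rightarrow> ('b, 'eb::banach) atlas \<Rightarrow> ('p \<Rightarrow> 'b) \<Rightarrow> 'b set \<Rightarrow> ('p \<Rightarrow> 'b \<times> 'g) \<Rightarrow> bool" where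
  "local_trivialization P act G B \<pi> U \<Phi> \<longleftrightarrow>
     (let PU = {p \<in> points P. \<pi> p \<in> U} in
        manifold_open B U \<and>
        bij_betw \<Phi> PU (U \<times> carrier G) \<and>
        smooth_map_on P PU (prod_atlas B (group_atlas G)) \<Phi> \<and>
        smooth_map_on (prod_atlas B (group_atlas G)) (U \<times> carrier G) P (inv_into PU \<Phi>) \<and>
        (\<forall>p\<in>PU. fst (\<Phi> p) = \<pi> p) \<and>
        (\<forall>p\<in>PU. \<forall>g\<in>carrier G. \<Phi> (act p g) = (fst (\<Phi> p), snd (\<Phi> p) \<otimes>\<^bsub>G\<^esub> g)))"

locale principal_bundle = banach_lie_group G
  for P :: "('p, 'ep::banach) atlas"
    and act :: "'p \<Rightarrow> 'g \<Rightarrow> 'p"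
    and G :: "('g, 'eg::banach) charted_group" (structure)
    and B :: "('b, 'eb::banach) atlas"
    and \<pi> :: "'p \<Rightarrow> 'b" +
  assumes total_manifold: "banach_manifold P"
    and base_manifold: "banach_manifold B"
    and smooth_projection: "smooth_map_on P (points P) B \<pi>"
    and smooth_action:
      "smooth_map_on (prod_atlas P (group_atlas G)) (points P \<times> carrier G) P (\<lambda>(p, g). act p g)"
    and act_one: "p \<in> points P \<Longrightarrow> act p \<one> = p"
    and act_mult: "\<lbrakk>p \<in> points P; a \<in> carrier G; b \<in> carrier G\<rbrakk>
                     \<Longrightarrow> act p (a \<otimes> b) = act (act p a) b"
    and projection_act: "\<lbrakk>p \<in> points P; a \<in> carrier G\<rbrakk> \<Longrightarrow> \<pi> (act p a) = \<pi> p"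
    and locally_trivial:
      "x \<in> points B \<Longrightarrow> \<exists>U \<Phi>. x \<in> U \<and> local_trivialization P act G B \<pi> U \<Phi>"

definition natural_section ::
    "('p, 'ep::banach) atlas \<Rightarrow> ('g, 'eg::banach) charted_group \<Rightarrow> ('p \<Rightarrow> 'b)
       \<Rightarrow> 'b set \<Rightarrow> ('p \<Rightarrow> 'b \<times> 'g) \<Rightarrow> 'b \<Rightarrow> 'p" where
  "natural_section P G \<pi> U \<Phi> x = inv_into {p \<in> points P. \<pi> p \<in> U} \<Phi> (x, \<one>\<^bsub>G\<^esub>)"

text \<open>Morphisms over the identity of the common base:\<close>

definition principal_bundle_morphism ::
    "('p, 'ep::banach) atlas \<Rightarrow> ('p \<Rightarrow> 'g \<Rightarrow> 'p) \<Rightarrow> ('g, 'eg::banach) charted_group \<Rightarrow> ('p \<Rightarrow> 'b)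
       \<Rightarrow> ('q, 'eq::banach) atlas \<Rightarrow> ('q \<Rightarrow> 'h \<Rightarrow> 'q) \<Rightarrow> ('h, 'eh::banach) charted_group \<Rightarrow> ('q \<Rightarrow> 'b)
       \<Rightarrow> ('p \<Rightarrow> 'q) \<Rightarrow> ('g \<Rightarrow> 'h) \<Rightarrow> bool" where
  "principal_bundle_morphism P actP G \<pi>P Q actQ H \<pi>Q f \<phi> \<longleftrightarrow>
     smooth_map_on P (points P) Q f \<and>
     lie_group_hom G H \<phi> \<and>
     (\<forall>p\<in>points P. \<pi>Q (f p) = \<pi>P p) \<and>
     (\<forall>p\<in>points P. \<forall>g\<in>carrier G. f (actP p g) = actQ (f p) (\<phi> g))"


section \<open>Connections\<close>

type_synonym ('a, 'e, 'g, 'f) lie_form = "'a \<Rightarrow> ('a, 'e) tangent \<Rightarrow> ('g, 'f) tangent"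

text \<open>
  The local representative of a form in a chart \<open>c\<close> of \<open>M\<close> and a chart \<open>k\<close> of \<open>G\<close> around the unit;
  the latter identifies the Lie algebra with the model space of \<open>G\<close>.
\<close>

definition form_rep ::
    "('a, 'e::banach) atlas \<Rightarrow> ('a, 'e) chart \<Rightarrow> ('g, 'f::banach) chart
       \<Rightarrow> ('a, 'e, 'g, 'f) lie_form \<Rightarrow> 'e \<Rightarrow> 'e \<Rightarrow> 'f" where
  "form_rep M c k \<omega> y v = \<omega> (chart_inv c y) (chart_tangent M c (chart_inv c y) v) k"

text \<open>
  Smoothness of a form means smoothness of its local representatives as maps into the Banach space
  of bounded linear operators. Linearity of the form is included as well: addition and scaling in
  the tangent spaces are determined by the components in a chart.
\<close>

definition smooth_lie_form ::
    "('a, 'e::banach) atlas \<Rightarrow> ('g, 'f::banach) charted_group \<Rightarrow> ('a, 'e, 'g, 'f) lie_form \<Rightarrow> bool"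
  where
  "smooth_lie_form M G \<omega> \<longleftrightarrow>
     (\<forall>p\<in>points M. \<omega> p ` tangent_space M p \<subseteq> lie_algebra G) \<and>
     (\<forall>c\<in>M. \<forall>k\<in>charts_at (group_atlas G) \<one>\<^bsub>G\<^esub>.
        (\<forall>y\<in>snd c ` fst c. bounded_linear (form_rep M c k \<omega> y)) \<and>
        smooth_on (snd c ` fst c) (\<lambda>y. Blinfun (form_rep M c k \<omega> y)))"

definition pullback_form ::
    "('a, 'e::banach) atlas \<Rightarrow> ('b, 'e'::banach) atlas \<Rightarrow> ('a \<Rightarrow> 'b)
       \<Rightarrow> ('b, 'e', 'g, 'f) lie_form \<Rightarrow> ('a, 'e, 'g, 'f) lie_form" where
  "pullback_form M N f \<omega> x v = \<omega> (f x) (tangent_map M N f x v)"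

definition fundamental_field ::
    "('p, 'ep::banach) atlas \<Rightarrow> ('p \<Rightarrow> 'g \<Rightarrow> 'p) \<Rightarrow> ('g, 'eg::banach) charted_group
       \<Rightarrow> ('g, 'eg) tangent \<Rightarrow> 'p \<Rightarrow> ('p, 'ep) tangent" where
  "fundamental_field P act G X p = tangent_map (group_atlas G) P (\<lambda>g. act p g) \<one>\<^bsub>G\<^esub> X"

definition connection_form ::
    "('p, 'ep::banach) atlas \<Rightarrow> ('p \<Rightarrow> 'g \<Rightarrow> 'p) \<Rightarrow> ('g, 'eg::banach) charted_group
       \<Rightarrow> ('p, 'ep, 'g, 'eg) lie_form \<Rightarrow> bool" where
  "connection_form P act G \<omega> \<longleftrightarrow>
     smooth_lie_form P G \<omega> \<and>
     (\<forall>X\<in>lie_algebra G. \<forall>p\<in>points P. \<omega> p (fundamental_field P act G X p) = X) \<and>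
     (\<forall>g\<in>carrier G. \<forall>p\<in>points P. \<forall>u\<in>tangent_space P p.
        pullback_form P P (\<lambda>p. act p g) \<omega> p u = Ad G (inv\<^bsub>G\<^esub> g) (\<omega> p u))"

definition related_connections ::
    "('p, 'ep::banach) atlas \<Rightarrow> ('q, 'eq::banach) atlas
       \<Rightarrow> ('g, 'eg::banach) charted_group \<Rightarrow> ('h, 'eh::banach) charted_group
       \<Rightarrow> ('p \<Rightarrow> 'q) \<Rightarrow> ('g \<Rightarrow> 'h)
       \<Rightarrow> ('p, 'ep, 'g, 'eg) lie_form \<Rightarrow> ('q, 'eq, 'h, 'eh) lie_form \<Rightarrow> bool" where
  "related_connections P Q G H f \<phi> \<omega> \<theta> \<longleftrightarrow>
     (\<forall>p\<in>points P. \<forall>u\<in>tangent_space P p.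
        pullback_form P Q f \<theta> p u = lie_algebra_map G H \<phi> (\<omega> p u))"

definition local_connection_form ::
    "('p, 'ep::banach) atlas \<Rightarrow> ('g, 'eg::banach) charted_group \<Rightarrow> ('b, 'eb::banach) atlas
       \<Rightarrow> ('p \<Rightarrow> 'b) \<Rightarrow> 'b set \<Rightarrow> ('p \<Rightarrow> 'b \<times> 'g) \<Rightarrow> ('p, 'ep, 'g, 'eg) lie_form
       \<Rightarrow> ('b, 'eb, 'g, 'eg) lie_form" where
  "local_connection_form P G B \<pi> U \<Phi> \<omega> = pullback_form B P (natural_section P G \<pi> U \<Phi>) \<omega>"

end

theory Submission
  imports Defs
begin

text \<open>
  The statement is local in \<open>P\<close>. The points over \<open>U \<alpha>\<close> are uniquely of the form
  \<open>p = s(\<pi> p) \<gamma>(p)\<close>, where \<open>s\<close> is the natural section and \<open>\<gamma>\<close> the group component of the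
  trivialization. The proof rests on the behaviour of a connection form \<open>\<theta>\<close> under a product
  \<open>x \<mapsto> \<sigma>(x) k(x)\<close> of a map \<open>\<sigma>\<close> into the bundle and a map \<open>k\<close> into the structure group:

    \<open>\<theta>(T(\<sigma> k) v) = Ad(k\<inverse>) \<theta>(T\<sigma> v) + (k\<inverse> dk)(v)\<close>

  (lemma \<open>connection_form_action\<close>). It follows from the Leibniz rule
  \<open>T(\<sigma> k) v = T(R\<^sub>k) (T\<sigma> v) + (k\<inverse> dk (v))\<^sup>*\<close> and the two defining properties of a connection form.

  Applied to \<open>f \<circ> s = t h\<close>, the formula says that the right-hand side of the asserted local equation
  is \<open>\<theta>(Tf (Ts v))\<close>. The local equation is therefore relatedness on the vectors \<open>Ts v\<close>,
  which gives one implication. For the converse, apply the formula to \<open>p = s(\<pi> p) \<gamma>(p)\<close> in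
  \<open>P\<close> and to \<open>f(p) = f(s(\<pi> p)) \<phi>(\<gamma>(p))\<close> in \<open>Q\<close>:

    \<open>\<omega>(u) = Ad(\<gamma>\<inverse>) \<omega>(Ts (T\<pi> u)) + (\<gamma>\<inverse> d\<gamma>)(u)\<close>,

    \<open>\<theta>(Tf u) = Ad(\<phi>(\<gamma>)\<inverse>) \<theta>(Tf (Ts (T\<pi> u))) + (\<phi>(\<gamma>)\<inverse> d\<phi>(\<gamma>))(u)\<close>.

  The differential of \<open>\<phi>\<close> intertwines the adjoint actions and the logarithmic differentials, so it
  carries the first right-hand side to the second as soon as the forms are related on \<open>Ts (T\<pi> u)\<close>.

  Only first derivatives at single points matter, so most of the calculus is done for maps
  that are merely differentiable at a point.
\<close>

section \<open>Maps differentiable at a point\<close>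

lemma has_derivative_cong_nhds:
  assumes "\<forall>\<^sub>F y in nhds x. f y = g y"
  shows "(f has_derivative D) (at x) \<longleftrightarrow> (g has_derivative D) (at x)"
proof -
  have "f x = g x" using assms by (auto simp: eventually_nhds)
  moreover have ev: "\<forall>\<^sub>F y in at x. f y = g y"
    using assms unfolding eventually_at_filter by (rule eventually_mono) simp
  moreover have "\<forall>\<^sub>F y in at x. g y = f y"
    using ev by (rule eventually_mono) simp
  ultimately show ?thesis
    using has_derivative_transform_eventually[of f D x UNIV g]
      has_derivative_transform_eventually[of g D x UNIV f] by auto
qed

lemma smooth_on_differentiable:
  assumes "smooth_on S f" "x \<in> S"
  shows "f differentiable (at x)"
proof -
  have S: "open S" using assms(1) by (simp add: smooth_on_def)
  from assms(1) obtain D :: "nat \<Rightarrow> 'a \<Rightarrow> 'a list \<Rightarrow> 'b" where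
    D0: "\<forall>x\<in>S. D 0 x [] = f x"
    and Dm: "\<forall>n. \<forall>x\<in>S. bounded_multilinear n (D n x)"
    and Dd: "\<forall>n. \<forall>x\<in>S. \<forall>e>0. \<exists>d>0. \<forall>y\<in>S. norm (y - x) < d \<longrightarrow>
           (\<forall>vs. length vs = n \<longrightarrow>
              norm (D n y vs - D n x vs - D (Suc n) x ((y - x) # vs))
                \<le> e * norm (y - x) * prod_list (map norm vs))"
    unfolding smooth_on_def by (elim conjE exE) (rule that)
  let ?f' = "\<lambda>v. D 1 x [v]"
  have "bounded_multilinear 1 (D 1 x)" using Dm assms(2) by blast
  then obtain K where "linear (\<lambda>v. D 1 x ([] @ v # []))"
    and K: "\<And>vs. length vs = 1 \<Longrightarrow> norm (D 1 x vs) \<le> K * prod_list (map norm vs)"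
    unfolding bounded_multilinear_def by (metis One_nat_def add.right_neutral list.size(3))
  then have lin: "linear ?f'" by simp
  have "norm (?f' v) \<le> norm v * K" for v
    using K[of "[v]"] by (simp add: mult.commute)
  then have bl: "bounded_linear ?f'"
    using lin by (intro bounded_linear.intro bounded_linear_axioms.intro) blast+
  have "\<exists>d>0. \<forall>y\<in>S. norm (y - x) < d \<longrightarrow> norm (f y - f x - ?f' (y - x)) \<le> e * norm (y - x)"
    if e: "e > 0" for e
  proof -
    obtain d where "d > 0" and d: "\<forall>y\<in>S. norm (y - x) < d \<longrightarrow>
           (\<forall>vs. length vs = 0 \<longrightarrow>
              norm (D 0 y vs - D 0 x vs - D (Suc 0) x ((y - x) # vs))
                \<le> e * norm (y - x) * prod_list (map norm vs))"
      using Dd[rule_format, OF assms(2) e, of 0] by (elim exE conjE)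
    then show ?thesis
      using D0 assms(2) by (intro exI[of _ d]) simp
  qed
  then have "(f has_derivative ?f') (at x within S)"
    using bl unfolding has_derivative_within_alt by blast
  then show ?thesis
    using at_within_open[OF assms(2) S] by (auto simp: differentiable_def)
qed

text \<open>
  The part of \<^const>\<open>banach_manifold\<close> that does not concern the transition maps. Unlike the latter,
  it passes to products at once.
\<close>

definition open_charts :: "('a, 'e::banach) atlas \<Rightarrow> bool" where
  "open_charts M \<longleftrightarrow> (\<forall>c\<in>M. inj_on (snd c) (fst c) \<and> open (snd c ` fst c))"

text \<open>
  Differentiability of \<open>f\<close> at the point \<open>p\<close>. The first condition on the charts is continuity at
  \<open>p\<close>; \<open>f\<close> may take arbitrary values away from \<open>p\<close>.
\<close>

definition differentiable_map_at ::
    "('a, 'e::banach) atlas \<Rightarrow> ('b, 'f::banach) atlas \<Rightarrow> ('a \<Rightarrow> 'b) \<Rightarrow> 'a \<Rightarrow> bool" where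
  "differentiable_map_at M N f p \<longleftrightarrow> p \<in> points M \<and> f p \<in> points N \<and>
     (\<forall>c\<in>charts_at M p. \<forall>k\<in>charts_at N (f p).
        (\<forall>\<^sub>F y in nhds (snd c p). y \<in> snd c ` fst c \<and> f (chart_inv c y) \<in> fst k) \<and>
        local_rep c k f differentiable (at (snd c p)))"

lemma banach_manifold_open_charts: "banach_manifold M \<Longrightarrow> open_charts M"
  by (simp add: banach_manifold_def open_charts_def)

lemma chart_inv_chart:
  assumes "open_charts M" "c \<in> M" "x \<in> fst c"
  shows "chart_inv c (snd c x) = x"
  using assms by (simp add: open_charts_def chart_inv_def)

lemma charts_atD:
  assumes "c \<in> charts_at M p"
  shows "c \<in> M" "p \<in> fst c" "p \<in> points M"
  using assms by (auto simp: charts_at_def points_def)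

lemma chart_inv_chart_at:
  assumes "open_charts M" "c \<in> charts_at M p"
  shows "chart_inv c (snd c p) = p"
  by (rule chart_inv_chart[OF assms(1) charts_atD(1,2)[OF assms(2)]])

lemma some_chart_at:
  assumes "p \<in> points M"
  shows "(SOME c. c \<in> charts_at M p) \<in> charts_at M p"
proof -
  have "\<exists>c. c \<in> charts_at M p" using assms unfolding points_def charts_at_def by blast
  then show ?thesis by (rule someI_ex)
qed

lemma eventually_chart_image:
  assumes "open_charts M" "c \<in> charts_at M p"
  shows "\<forall>\<^sub>F y in nhds (snd c p). y \<in> snd c ` fst c"
  using assms by (intro eventually_nhds_in_open) (auto simp: open_charts_def charts_at_def)

lemma eventually_manifold_open:
  assumes M: "open_charts M" and W: "manifold_open M W" "p \<in> W" and c: "c \<in> charts_at M p"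
  shows "\<forall>\<^sub>F y in nhds (snd c p). chart_inv c y \<in> W"
proof -
  have "\<forall>\<^sub>F y in nhds (snd c p). y \<in> snd c ` (fst c \<inter> W)"
    using W c by (intro eventually_nhds_in_open) (auto simp: manifold_open_def charts_at_def)
  then show ?thesis
    by (rule eventually_mono) (use chart_inv_chart[OF M charts_atD(1)[OF c]] in auto)
qed

lemma differentiable_map_atD:
  assumes "differentiable_map_at M N f p" "c \<in> charts_at M p" "k \<in> charts_at N (f p)"
  shows "\<forall>\<^sub>F y in nhds (snd c p). y \<in> snd c ` fst c \<and> f (chart_inv c y) \<in> fst k"
    and "local_rep c k f differentiable (at (snd c p))"
    and "(local_rep c k f has_derivative frechet_derivative (local_rep c k f) (at (snd c p)))
           (at (snd c p))"
    and "linear (frechet_derivative (local_rep c k f) (at (snd c p)))"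
proof -
  show 1: "local_rep c k f differentiable (at (snd c p))"
    and "\<forall>\<^sub>F y in nhds (snd c p). y \<in> snd c ` fst c \<and> f (chart_inv c y) \<in> fst k"
    using assms by (auto simp: differentiable_map_at_def)
  show 2: "(local_rep c k f has_derivative frechet_derivative (local_rep c k f) (at (snd c p)))
           (at (snd c p))"
    using 1 by (simp add: frechet_derivative_works)
  show "linear (frechet_derivative (local_rep c k f) (at (snd c p)))"
    using 2 by (intro bounded_linear.linear has_derivative_bounded_linear)
qed

lemma differentiable_map_at_points:
  assumes "differentiable_map_at M N f p"
  shows "p \<in> points M" "f p \<in> points N"
  using assms by (auto simp: differentiable_map_at_def)

lemma smooth_map_on_differentiable:
  assumes M: "open_charts M" and f: "smooth_map_on M W N f" and p: "p \<in> W"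
  shows "differentiable_map_at M N f p"
  unfolding differentiable_map_at_def
proof (intro conjI ballI)
  show "p \<in> points M" "f p \<in> points N"
    using f p by (auto simp: smooth_map_on_def manifold_open_def)
  fix c k assume c: "c \<in> charts_at M p" and k: "k \<in> charts_at N (f p)"
  let ?S = "snd c ` (fst c \<inter> W \<inter> f -` fst k)"
  have s: "smooth_on ?S (local_rep c k f)"
    using f c k by (auto simp: smooth_map_on_def charts_at_def)
  have S: "snd c p \<in> ?S" using p c k by (auto simp: charts_at_def)
  show "local_rep c k f differentiable (at (snd c p))"
    using smooth_on_differentiable[OF s S] .
  have "\<forall>\<^sub>F y in nhds (snd c p). y \<in> ?S"
    using s S by (intro eventually_nhds_in_open) (auto simp: smooth_on_def)
  then show "\<forall>\<^sub>F y in nhds (snd c p). y \<in> snd c ` fst c \<and> f (chart_inv c y) \<in> fst k"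
    by (rule eventually_mono) (use chart_inv_chart[OF M charts_atD(1)[OF c]] in auto)
qed

lemma differentiable_map_at_id:
  assumes M: "banach_manifold M" and p: "p \<in> points M"
  shows "differentiable_map_at M M id p"
proof -
  note oc = banach_manifold_open_charts[OF M]
  have eq: "fst c \<inter> points M = fst c" if "c \<in> M" for c
    using that by (auto simp: points_def)
  have "smooth_map_on M (points M) M id"
    using M oc by (auto simp: smooth_map_on_def banach_manifold_def manifold_open_def
        open_charts_def eq simp del: split_paired_All)
  then show ?thesis by (rule smooth_map_on_differentiable[OF oc _ p])
qed

lemma differentiable_map_at_const:
  assumes M: "open_charts M" and p: "p \<in> points M" and q: "q \<in> points N"
  shows "differentiable_map_at M N (\<lambda>_. q) p"
  unfolding differentiable_map_at_def local_rep_def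
  using p q eventually_chart_image[OF M] by (auto simp: o_def charts_at_def)

text \<open>
  The chain rule in charts. The intermediate chart \<open>c'\<close> is arbitrary, so the case where \<open>f\<close> or
  \<open>g\<close> is the identity describes changes of charts.
\<close>

lemma has_derivative_local_rep_comp:
  assumes M: "open_charts M" and N: "open_charts N"
    and f: "differentiable_map_at M N f p" and g: "differentiable_map_at N L g (f p)"
    and c: "c \<in> charts_at M p" and c': "c' \<in> charts_at N (f p)" and k: "k \<in> charts_at L (g (f p))"
  shows "(local_rep c k (g \<circ> f) has_derivative
            frechet_derivative (local_rep c' k g) (at (snd c' (f p)))
              \<circ> frechet_derivative (local_rep c c' f) (at (snd c p))) (at (snd c p))"
    and "\<forall>\<^sub>F y in nhds (snd c p). y \<in> snd c ` fst c \<and> (g \<circ> f) (chart_inv c y) \<in> fst k"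
proof -
  note df = differentiable_map_atD[OF f c c'] and dg = differentiable_map_atD[OF g c' k]
  have val: "local_rep c c' f (snd c p) = snd c' (f p)"
    by (simp add: local_rep_def chart_inv_chart_at[OF M c])
  have inv: "chart_inv c' (local_rep c c' f y) = f (chart_inv c y)" if "f (chart_inv c y) \<in> fst c'" for y
    using chart_inv_chart[OF N charts_atD(1)[OF c'] that] by (simp add: local_rep_def)
  have ev: "\<forall>\<^sub>F y in nhds (snd c p). local_rep c' k g (local_rep c c' f y) = local_rep c k (g \<circ> f) y"
    using df(1) by (rule eventually_mono) (use inv in \<open>auto simp: local_rep_def\<close>)
  have "(local_rep c' k g \<circ> local_rep c c' f has_derivative
            frechet_derivative (local_rep c' k g) (at (snd c' (f p)))
              \<circ> frechet_derivative (local_rep c c' f) (at (snd c p))) (at (snd c p))"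
    using df(3) dg(3) by (intro diff_chain_at) (simp_all add: val)
  then show "(local_rep c k (g \<circ> f) has_derivative
            frechet_derivative (local_rep c' k g) (at (snd c' (f p)))
              \<circ> frechet_derivative (local_rep c c' f) (at (snd c p))) (at (snd c p))"
    using has_derivative_cong_nhds[of "local_rep c' k g \<circ> local_rep c c' f"] ev by (simp add: o_def)
  have "isCont (local_rep c c' f) (snd c p)"
    using df(3) has_derivative_continuous by blast
  then have "filterlim (local_rep c c' f) (nhds (snd c' (f p))) (nhds (snd c p))"
    unfolding isCont_def using tendsto_at_iff_tendsto_nhds[of "local_rep c c' f" "snd c p"] val by simp
  then have "\<forall>\<^sub>F y in nhds (snd c p). g (chart_inv c' (local_rep c c' f y)) \<in> fst k"
    using dg(1) unfolding filterlim_iff by (auto elim: eventually_mono)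
  then show "\<forall>\<^sub>F y in nhds (snd c p). y \<in> snd c ` fst c \<and> (g \<circ> f) (chart_inv c y) \<in> fst k"
    using df(1) by eventually_elim (use inv in auto)
qed

lemma differentiable_map_at_comp:
  assumes M: "open_charts M" and N: "open_charts N"
    and f: "differentiable_map_at M N f p" and g: "differentiable_map_at N L g (f p)"
  shows "differentiable_map_at M L (g \<circ> f) p"
proof -
  obtain c' where c': "c' \<in> charts_at N (f p)"
    using some_chart_at[OF differentiable_map_at_points(2)[OF f]] by (rule that)
  show ?thesis
    unfolding differentiable_map_at_def
  proof (intro conjI ballI)
    show "p \<in> points M" "(g \<circ> f) p \<in> points L"
      using differentiable_map_at_points[OF f] differentiable_map_at_points[OF g] by simp_all
    fix c k assume "c \<in> charts_at M p" "k \<in> charts_at L ((g \<circ> f) p)"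
    then have c: "c \<in> charts_at M p" and k: "k \<in> charts_at L (g (f p))" by simp_all
    show "local_rep c k (g \<circ> f) differentiable (at (snd c p))"
      using has_derivative_local_rep_comp(1)[OF M N f g c c' k] by (rule differentiableI)
    show "\<forall>\<^sub>F y in nhds (snd c p). y \<in> snd c ` fst c \<and> (g \<circ> f) (chart_inv c y) \<in> fst k"
      using has_derivative_local_rep_comp(2)[OF M N f g c c' k] .
  qed
qed


section \<open>Tangent maps\<close>

lemma tangent_map_zero: "k \<notin> charts_at N (f p) \<Longrightarrow> tangent_map M N f p u k = 0"
  by (simp add: tangent_map_def)

text \<open>
  The next two lemmas hold for every family of components \<open>u\<close>, tangent vector or not, because
  \<open>tangent_map M N f p\<close> reads \<open>u\<close> only in one chart, chosen independently of \<open>f\<close> and \<open>N\<close>.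
\<close>

lemma tangent_map_comp:
  assumes M: "open_charts M" and N: "open_charts N"
    and f: "differentiable_map_at M N f p" and g: "differentiable_map_at N L g (f p)"
  shows "tangent_map M L (g \<circ> f) p u = tangent_map N L g (f p) (tangent_map M N f p u)"
proof
  fix k
  let ?c = "SOME c. c \<in> charts_at M p" and ?c' = "SOME c. c \<in> charts_at N (f p)"
  have c: "?c \<in> charts_at M p" and c': "?c' \<in> charts_at N (f p)"
    using differentiable_map_at_points[OF f] by (auto intro: some_chart_at)
  show "tangent_map M L (g \<circ> f) p u k = tangent_map N L g (f p) (tangent_map M N f p u) k"
  proof (cases "k \<in> charts_at L (g (f p))")
    case True
    have "frechet_derivative (local_rep ?c k (g \<circ> f)) (at (snd ?c p)) w
        = frechet_derivative (local_rep ?c' k g) (at (snd ?c' (f p)))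
            (frechet_derivative (local_rep ?c ?c' f) (at (snd ?c p)) w)" for w
      using frechet_derivative_at[OF has_derivative_local_rep_comp(1)[OF M N f g c c' True],
          THEN fun_cong, of w] by simp
    then show ?thesis
      using True c' by (simp add: tangent_map_def Let_def)
  qed (simp add: tangent_map_zero)
qed

lemma tangent_map_add:
  assumes f: "differentiable_map_at M N f p"
  shows "tangent_map M N f p (u + w) = tangent_map M N f p u + tangent_map M N f p w"
proof
  fix k
  have "(SOME c. c \<in> charts_at M p) \<in> charts_at M p"
    by (rule some_chart_at[OF differentiable_map_at_points(1)[OF f]])
  from differentiable_map_atD(4)[OF f this]
  show "tangent_map M N f p (u + w) k = (tangent_map M N f p u + tangent_map M N f p w) k"
    by (simp add: tangent_map_def Let_def linear_add)
qed

lemma tangent_map_in_tangent_space: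
  assumes M: "open_charts M" and N: "banach_manifold N" and f: "differentiable_map_at M N f p"
  shows "tangent_map M N f p u \<in> tangent_space N (f p)"
proof -
  let ?c = "SOME c. c \<in> charts_at M p"
  have c: "?c \<in> charts_at M p"
    by (rule some_chart_at[OF differentiable_map_at_points(1)[OF f]])
  have id: "differentiable_map_at N N id (f p)"
    using differentiable_map_at_id[OF N] differentiable_map_at_points[OF f] by blast
  have "tangent_map M N f p u k
      = frechet_derivative (transition c' k) (at (snd c' (f p))) (tangent_map M N f p u c')"
    if c': "c' \<in> charts_at N (f p)" and k: "k \<in> charts_at N (f p)" for c' k
    using frechet_derivative_at[OF has_derivative_local_rep_comp(1)
        [OF M banach_manifold_open_charts[OF N] f id c c'], THEN fun_cong, of k "u ?c"] k c'
    by (simp add: tangent_map_def Let_def)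
  then show ?thesis
    unfolding tangent_space_def
    by (intro CollectI conjI ballI allI impI) (assumption | rule tangent_map_zero)+
qed

lemma tangent_map_id:
  assumes u: "u \<in> tangent_space M p" and p: "p \<in> points M"
  shows "tangent_map M M id p u = u"
proof
  fix k
  let ?c = "SOME c. c \<in> charts_at M p"
  show "tangent_map M M id p u k = u k"
  proof (cases "k \<in> charts_at M p")
    case True
    then have "u k = frechet_derivative (transition ?c k) (at (snd ?c p)) (u ?c)"
      using u some_chart_at[OF p] unfolding tangent_space_def by blast
    then show ?thesis by (simp only: tangent_map_def Let_def id_apply if_True True)
  next
    case False
    then have "u k = 0" using u unfolding tangent_space_def by blast
    then show ?thesis using False by (simp add: tangent_map_def)
  qed
qed

lemma tangent_map_cong:
  fixes N :: "('b, 'f::banach) atlas"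
  assumes M: "open_charts M" and W: "manifold_open M W" "p \<in> W"
    and eq: "\<And>x. x \<in> W \<Longrightarrow> f x = g x"
  shows "tangent_map M N f p u = tangent_map M N g p u"
proof
  fix k :: "('b, 'f) chart"
  let ?c = "SOME c. c \<in> charts_at M p"
  have c: "?c \<in> charts_at M p"
    using W by (intro some_chart_at) (auto simp: manifold_open_def)
  have ev: "\<forall>\<^sub>F y in nhds (snd ?c p). local_rep ?c k f y = local_rep ?c k g y"
    using eventually_manifold_open[OF M W c] by (rule eventually_mono) (simp add: local_rep_def eq)
  have "(local_rep ?c k f has_derivative D) (at (snd ?c p))
      \<longleftrightarrow> (local_rep ?c k g has_derivative D) (at (snd ?c p))" for D
    using has_derivative_cong_nhds[OF ev] .
  then show "tangent_map M N f p u k = tangent_map M N g p u k"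
    using eq[OF W(2)] by (simp add: tangent_map_def Let_def frechet_derivative_def)
qed

text \<open>
  A tangent space is the set of fixed points of the tangent map of the identity, which is additive.
\<close>

lemma tangent_space_add:
  assumes M: "banach_manifold M" and p: "p \<in> points M"
    and u: "u \<in> tangent_space M p" "w \<in> tangent_space M p"
  shows "u + w \<in> tangent_space M p"
  using tangent_map_in_tangent_space[OF banach_manifold_open_charts[OF M] M
      differentiable_map_at_id[OF M p], of "u + w"]
    tangent_map_add[OF differentiable_map_at_id[OF M p]] tangent_map_id[OF u(1) p] tangent_map_id[OF u(2) p]
  by simp


section \<open>Maps into and out of a product\<close>

lemma points_prod_atlas: "points (prod_atlas M N) = points M \<times> points N"
  by (auto simp: points_def prod_atlas_def)

lemma open_charts_prod:
  assumes "open_charts M" "open_charts N"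
  shows "open_charts (prod_atlas M N)"
  unfolding open_charts_def
proof (intro ballI conjI)
  fix c assume "c \<in> prod_atlas M N"
  then obtain a b where ab: "a \<in> M" "b \<in> N"
    and c: "c = (fst a \<times> fst b, map_prod (snd a) (snd b))"
    by (auto simp: prod_atlas_def)
  have o: "inj_on (snd a) (fst a)" "open (snd a ` fst a)" "inj_on (snd b) (fst b)" "open (snd b ` fst b)"
    using assms ab by (simp_all add: open_charts_def)
  show "inj_on (snd c) (fst c)" using o(1,3) by (simp add: c map_prod_inj_on)
  have "snd c ` fst c = (snd a ` fst a) \<times> (snd b ` fst b)" by (simp add: c map_prod_surj_on)
  then show "open (snd c ` fst c)" using o(2,4) by (simp add: open_Times)
qed

lemma charts_at_prod_atlasE:
  assumes "k \<in> charts_at (prod_atlas M N) pq"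
  obtains a b where "a \<in> charts_at M (fst pq)" "b \<in> charts_at N (snd pq)"
    and "k = (fst a \<times> fst b, map_prod (snd a) (snd b))"
  using assms by (auto simp: charts_at_def prod_atlas_def)

lemma local_rep_pair:
  "local_rep c (A, map_prod (snd a) (snd b)) (\<lambda>x. (f x, g x)) = (\<lambda>y. (local_rep c a f y, local_rep c b g y))"
  by (simp add: local_rep_def fun_eq_iff)

lemma differentiable_map_at_Pair:
  assumes f: "differentiable_map_at L M f x" and g: "differentiable_map_at L N g x"
  shows "differentiable_map_at L (prod_atlas M N) (\<lambda>x. (f x, g x)) x"
  unfolding differentiable_map_at_def
proof (intro conjI ballI)
  show "x \<in> points L" "(f x, g x) \<in> points (prod_atlas M N)"
    using differentiable_map_at_points[OF f] differentiable_map_at_points[OF g]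
    by (simp_all add: points_prod_atlas)
  fix c k assume c: "c \<in> charts_at L x" and "k \<in> charts_at (prod_atlas M N) (f x, g x)"
  then obtain a b where a: "a \<in> charts_at M (f x)" and b: "b \<in> charts_at N (g x)"
    and k: "k = (fst a \<times> fst b, map_prod (snd a) (snd b))"
    by (auto elim: charts_at_prod_atlasE)
  show "local_rep c k (\<lambda>x. (f x, g x)) differentiable (at (snd c x))"
    unfolding k local_rep_pair
    by (rule differentiableI[OF has_derivative_Pair])
      (rule differentiable_map_atD(3)[OF f c a] differentiable_map_atD(3)[OF g c b])+
  show "\<forall>\<^sub>F y in nhds (snd c x). y \<in> snd c ` fst c \<and> (f (chart_inv c y), g (chart_inv c y)) \<in> fst k"
    using differentiable_map_atD(1)[OF f c a] differentiable_map_atD(1)[OF g c b]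
    by eventually_elim (simp add: k)
qed

text \<open>
  The tangent vector of a pair is the sum of its components, each embedded by keeping the other
  coordinate constant. Stating it with constants avoids identifying the tangent space of a product
  with a product of tangent spaces.
\<close>

lemma tangent_map_Pair_add:
  assumes f: "differentiable_map_at L M f x" and g: "differentiable_map_at L N g x"
    and p: "p = f x" and q: "q = g x"
  shows "tangent_map L (prod_atlas M N) (\<lambda>x. (f x, g x)) x v
    = tangent_map L (prod_atlas M N) (\<lambda>x. (f x, q)) x v
      + tangent_map L (prod_atlas M N) (\<lambda>x. (p, g x)) x v"
proof
  fix k
  let ?c = "SOME c. c \<in> charts_at L x"
  have c: "?c \<in> charts_at L x"
    by (rule some_chart_at[OF differentiable_map_at_points(1)[OF f]])
  show "tangent_map L (prod_atlas M N) (\<lambda>x. (f x, g x)) x v k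
    = (tangent_map L (prod_atlas M N) (\<lambda>x. (f x, q)) x v
      + tangent_map L (prod_atlas M N) (\<lambda>x. (p, g x)) x v) k"
  proof (cases "k \<in> charts_at (prod_atlas M N) (f x, g x)")
    case True
    then obtain a b where a: "a \<in> charts_at M (f x)" and b: "b \<in> charts_at N (g x)"
      and k: "k = (fst a \<times> fst b, map_prod (snd a) (snd b))"
      by (auto elim: charts_at_prod_atlasE)
    note df = differentiable_map_atD(3)[OF f c a] and dg = differentiable_map_atD(3)[OF g c b]
    have const: "local_rep ?c e (\<lambda>_. r) = (\<lambda>_. snd e r)" for e :: "('z, 'w) chart" and r
      by (simp add: local_rep_def o_def)
    have "((\<lambda>y. (local_rep ?c a f y, local_rep ?c b g y)) has_derivative
        (\<lambda>v. (frechet_derivative (local_rep ?c a f) (at (snd ?c x)) v,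
              frechet_derivative (local_rep ?c b g) (at (snd ?c x)) v))) (at (snd ?c x))"
      by (intro has_derivative_Pair df dg)
    moreover have "((\<lambda>y. (local_rep ?c a f y, snd b q)) has_derivative
        (\<lambda>v. (frechet_derivative (local_rep ?c a f) (at (snd ?c x)) v, 0))) (at (snd ?c x))"
      by (intro has_derivative_Pair df has_derivative_const)
    moreover have "((\<lambda>y. (snd a p, local_rep ?c b g y)) has_derivative
        (\<lambda>v. (0, frechet_derivative (local_rep ?c b g) (at (snd ?c x)) v))) (at (snd ?c x))"
      by (intro has_derivative_Pair dg has_derivative_const)
    ultimately show ?thesis
      using True p q
      by (simp add: tangent_map_def Let_def k local_rep_pair const flip: frechet_derivative_at)
  qed (simp add: tangent_map_zero p q)
qed

lemma differentiable_map_at_snd: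
  assumes M: "open_charts M" and N: "banach_manifold N" and p: "p \<in> points M" "q \<in> points N"
  shows "differentiable_map_at (prod_atlas M N) N snd (p, q)"
  unfolding differentiable_map_at_def
proof (intro conjI ballI)
  note oN = banach_manifold_open_charts[OF N]
  show "(p, q) \<in> points (prod_atlas M N)" "snd (p, q) \<in> points N"
    using p by (simp_all add: points_prod_atlas)
  fix c k assume c: "c \<in> charts_at (prod_atlas M N) (p, q)" and "k \<in> charts_at N (snd (p, q))"
  then obtain a b where a: "a \<in> charts_at M p" and b: "b \<in> charts_at N q" and k: "k \<in> charts_at N q"
    and ceq: "c = (fst a \<times> fst b, map_prod (snd a) (snd b))"
    by (auto elim: charts_at_prod_atlasE)
  note id = differentiable_map_atD[OF differentiable_map_at_id[OF N p(2)] b, unfolded id_apply, OF k]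
  have ev: "\<forall>\<^sub>F y in nhds (snd c (p, q)). y \<in> snd c ` fst c"
    by (rule eventually_chart_image[OF open_charts_prod[OF M oN] c])
  have inv: "snd (chart_inv c y) = chart_inv b (snd y)" if "y \<in> snd c ` fst c" for y
  proof -
    from that obtain r s where rs: "r \<in> fst a" "s \<in> fst b" and y: "y = snd c (r, s)"
      by (auto simp: ceq)
    have "chart_inv c y = (r, s)"
      unfolding y by (rule chart_inv_chart[OF open_charts_prod[OF M oN] charts_atD(1)[OF c]])
        (simp add: ceq rs)
    moreover have "chart_inv b (snd y) = s"
      using chart_inv_chart[OF oN charts_atD(1)[OF b] rs(2)] by (simp add: y ceq)
    ultimately show ?thesis by simp
  qed
  have h1: "((\<lambda>y. transition b k (snd y)) has_derivative
      (\<lambda>v. frechet_derivative (transition b k) (at (snd b q)) (snd v))) (at (snd c (p, q)))"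
    using diff_chain_at[OF has_derivative_snd[OF has_derivative_ident], of "transition b k" _ "snd c (p, q)"]
      id(3) by (simp add: o_def ceq id_def)
  have h2: "\<forall>\<^sub>F y in nhds (snd c (p, q)). transition b k (snd y) = local_rep c k snd y"
    using ev by (rule eventually_mono) (simp add: inv local_rep_def)
  show "local_rep c k snd differentiable (at (snd c (p, q)))"
    by (rule differentiableI[OF has_derivative_cong_nhds[OF h2, THEN iffD1, OF h1]])
  have "filterlim snd (nhds (snd b q)) (nhds (snd c (p, q)))"
    using tendsto_snd[OF filterlim_ident, of "snd c (p, q)"] by (simp add: ceq)
  then have "\<forall>\<^sub>F y in nhds (snd c (p, q)). snd y \<in> snd b ` fst b \<and> chart_inv b (snd y) \<in> fst k"
    by (rule eventually_compose_filterlim[OF id(1)])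
  then show "\<forall>\<^sub>F y in nhds (snd c (p, q)). y \<in> snd c ` fst c \<and> snd (chart_inv c y) \<in> fst k"
    using ev by eventually_elim (simp add: inv)
qed

text \<open>
  The differential of a map of two variables is the sum of its partial differentials.
\<close>

lemma tangent_map_partials:
  assumes L: "open_charts L" and M: "banach_manifold M" and N: "banach_manifold N"
    and a: "differentiable_map_at L M a x" and b: "differentiable_map_at L N b x"
    and F: "differentiable_map_at (prod_atlas M N) K (\<lambda>(p, q). F p q) (a x, b x)"
  shows "tangent_map L K (\<lambda>y. F (a y) (b y)) x v
      = tangent_map M K (\<lambda>p. F p (b x)) (a x) (tangent_map L M a x v)
        + tangent_map N K (\<lambda>q. F (a x) q) (b x) (tangent_map L N b x v)"
    and "differentiable_map_at L K (\<lambda>y. F (a y) (b y)) x"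
    and "differentiable_map_at M K (\<lambda>p. F p (b x)) (a x)"
    and "differentiable_map_at N K (\<lambda>q. F (a x) q) (b x)"
proof -
  note oM = banach_manifold_open_charts[OF M] and oN = banach_manifold_open_charts[OF N]
  note oMN = open_charts_prod[OF oM oN]
  let ?F = "\<lambda>(p, q). F p q"
  note pa = differentiable_map_at_points[OF a] and pb = differentiable_map_at_points[OF b]
  have pair: "differentiable_map_at L (prod_atlas M N) (\<lambda>y. (a y, b y)) x"
    by (rule differentiable_map_at_Pair[OF a b])
  have inl: "differentiable_map_at M (prod_atlas M N) (\<lambda>p. (id p, b x)) (a x)"
    by (intro differentiable_map_at_Pair differentiable_map_at_id differentiable_map_at_const M oM pa pb)
  have inr: "differentiable_map_at N (prod_atlas M N) (\<lambda>q. (a x, id q)) (b x)"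
    by (intro differentiable_map_at_Pair differentiable_map_at_id differentiable_map_at_const N oN pa pb)
  have a1: "differentiable_map_at L (prod_atlas M N) (\<lambda>y. (a y, b x)) x"
    by (intro differentiable_map_at_Pair differentiable_map_at_const L a pa pb)
  have b1: "differentiable_map_at L (prod_atlas M N) (\<lambda>y. (a x, b y)) x"
    by (intro differentiable_map_at_Pair differentiable_map_at_const L b pa pb)
  show "differentiable_map_at L K (\<lambda>y. F (a y) (b y)) x"
    using differentiable_map_at_comp[OF L oMN pair F] by (simp add: o_def)
  show l: "differentiable_map_at M K (\<lambda>p. F p (b x)) (a x)"
    using differentiable_map_at_comp[OF oM oMN inl, of K ?F] F by (simp add: o_def)
  show r: "differentiable_map_at N K (\<lambda>q. F (a x) q) (b x)"
    using differentiable_map_at_comp[OF oN oMN inr, of K ?F] F by (simp add: o_def)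
  have "tangent_map L K (\<lambda>y. F (a y) (b y)) x v
      = tangent_map (prod_atlas M N) K ?F (a x, b x) (tangent_map L (prod_atlas M N) (\<lambda>y. (a y, b y)) x v)"
    using tangent_map_comp[OF L oMN pair F] by (simp add: o_def)
  also have "\<dots> = tangent_map (prod_atlas M N) K ?F (a x, b x) (tangent_map L (prod_atlas M N) (\<lambda>y. (a y, b x)) x v)
      + tangent_map (prod_atlas M N) K ?F (a x, b x) (tangent_map L (prod_atlas M N) (\<lambda>y. (a x, b y)) x v)"
    by (simp only: tangent_map_Pair_add[OF a b refl refl] tangent_map_add[OF F])
  also have "tangent_map (prod_atlas M N) K ?F (a x, b x) (tangent_map L (prod_atlas M N) (\<lambda>y. (a y, b x)) x v)
      = tangent_map L K (\<lambda>y. F (a y) (b x)) x v"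
    using tangent_map_comp[OF L oMN a1, of K ?F] F by (simp add: o_def)
  also have "\<dots> = tangent_map M K (\<lambda>p. F p (b x)) (a x) (tangent_map L M a x v)"
    using tangent_map_comp[OF L oM a l] by (simp add: o_def)
  also have "tangent_map (prod_atlas M N) K ?F (a x, b x) (tangent_map L (prod_atlas M N) (\<lambda>y. (a x, b y)) x v)
      = tangent_map L K (\<lambda>y. F (a x) (b y)) x v"
    using tangent_map_comp[OF L oMN b1, of K ?F] F by (simp add: o_def)
  also have "\<dots> = tangent_map N K (\<lambda>q. F (a x) q) (b x) (tangent_map L N b x v)"
    using tangent_map_comp[OF L oN b r] by (simp add: o_def)
  finally show "tangent_map L K (\<lambda>y. F (a y) (b y)) x v
      = tangent_map M K (\<lambda>p. F p (b x)) (a x) (tangent_map L M a x v)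
        + tangent_map N K (\<lambda>q. F (a x) q) (b x) (tangent_map L N b x v)" .
qed


section \<open>Lie groups\<close>

context banach_lie_group
begin

lemma open_charts_group: "open_charts (group_atlas G)"
  by (rule banach_manifold_open_charts[OF manifold])

lemma manifold_open_carrier: "manifold_open (group_atlas G) (carrier G)"
  using smooth_inv by (simp add: smooth_map_on_def)

lemma differentiable_mult:
  assumes "a \<in> carrier G" "b \<in> carrier G"
  shows "differentiable_map_at (prod_atlas (group_atlas G) (group_atlas G)) (group_atlas G)
           (\<lambda>(a, b). a \<otimes> b) (a, b)"
  by (rule smooth_map_on_differentiable[OF open_charts_prod[OF open_charts_group open_charts_group]
        smooth_mult]) (simp add: assms)

lemma differentiable_left_translation:
  assumes "a \<in> carrier G" "b \<in> carrier G"
  shows "differentiable_map_at (group_atlas G) (group_atlas G) (\<lambda>b. a \<otimes> b) b"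
  using assms points_carrier
    tangent_map_partials(4)[OF open_charts_group manifold manifold
      differentiable_map_at_const[OF open_charts_group]
      differentiable_map_at_id[OF manifold], unfolded id_apply, OF _ _ _ differentiable_mult]
  by simp

lemma differentiable_conjugation:
  assumes "g \<in> carrier G" "b \<in> carrier G"
  shows "differentiable_map_at (group_atlas G) (group_atlas G) (\<lambda>a. g \<otimes> a \<otimes> inv g) b"
  by (rule tangent_map_partials(2)[OF open_charts_group manifold manifold
      differentiable_left_translation differentiable_map_at_const[OF open_charts_group] differentiable_mult])
    (simp_all add: assms points_carrier)

lemma log_differential_in_lie_algebra:
  assumes M: "open_charts M" and k: "differentiable_map_at M (group_atlas G) k x"
  shows "log_differential M G k x v \<in> lie_algebra G"
proof -
  have c: "k x \<in> carrier G" using differentiable_map_at_points[OF k] points_carrier by simp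
  then have "differentiable_map_at (group_atlas G) (group_atlas G) (\<lambda>b. inv (k x) \<otimes> b) (k x)"
    by (intro differentiable_left_translation) simp_all
  from tangent_map_in_tangent_space[OF open_charts_group manifold this] c
  show ?thesis by (simp add: log_differential_def lie_algebra_def)
qed

end

text \<open>A morphism of Lie groups, with its domain and codomain.\<close>

locale banach_lie_group_hom = G: banach_lie_group G + H: banach_lie_group H
  for G :: "('g, 'eg::banach) charted_group" and H :: "('h, 'eh::banach) charted_group" +
  fixes \<phi> :: "'g \<Rightarrow> 'h"
  assumes hom: "lie_group_hom G H \<phi>"
begin

sublocale group_hom G H \<phi>
  using hom by unfold_locales (simp add: lie_group_hom_def)

lemma differentiable_hom:
  assumes "a \<in> carrier G"
  shows "differentiable_map_at (group_atlas G) (group_atlas H) \<phi> a"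
  using hom by (intro smooth_map_on_differentiable[OF G.open_charts_group _ assms])
    (simp add: lie_group_hom_def)

lemma lie_algebra_map_add:
  "lie_algebra_map G H \<phi> (X + Y) = lie_algebra_map G H \<phi> X + lie_algebra_map G H \<phi> Y"
  unfolding lie_algebra_map_def by (intro tangent_map_add differentiable_hom) simp

text \<open>
  The differential of \<open>\<phi>\<close> intertwines the adjoint actions, because
  \<open>\<phi>(g a g\<inverse>) = \<phi>(g) \<phi>(a) \<phi>(g)\<inverse>\<close>.
\<close>

lemma lie_algebra_map_Ad:
  assumes g: "g \<in> carrier G"
  shows "lie_algebra_map G H \<phi> (Ad G g X) = Ad H (\<phi> g) (lie_algebra_map G H \<phi> X)"
proof -
  let ?cG = "\<lambda>a. g \<otimes>\<^bsub>G\<^esub> a \<otimes>\<^bsub>G\<^esub> inv\<^bsub>G\<^esub> g" and ?cH = "\<lambda>a. \<phi> g \<otimes>\<^bsub>H\<^esub> a \<otimes>\<^bsub>H\<^esub> inv\<^bsub>H\<^esub> (\<phi> g)"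
  have 1: "?cG \<one>\<^bsub>G\<^esub> = \<one>\<^bsub>G\<^esub>" using g by simp
  have "tangent_map (group_atlas G) (group_atlas H) (\<phi> \<circ> ?cG) \<one>\<^bsub>G\<^esub> X
      = lie_algebra_map G H \<phi> (Ad G g X)"
    unfolding Ad_def lie_algebra_map_def
    using tangent_map_comp[OF G.open_charts_group G.open_charts_group
        G.differentiable_conjugation[OF g G.one_closed], unfolded 1, OF differentiable_hom[OF G.one_closed]] .
  moreover have "tangent_map (group_atlas G) (group_atlas H) (?cH \<circ> \<phi>) \<one>\<^bsub>G\<^esub> X
      = Ad H (\<phi> g) (lie_algebra_map G H \<phi> X)"
    unfolding Ad_def lie_algebra_map_def
    using tangent_map_comp[OF G.open_charts_group H.open_charts_group
        differentiable_hom[OF G.one_closed], unfolded hom_one,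
        OF H.differentiable_conjugation[OF hom_closed[OF g] H.one_closed]] .
  moreover have "tangent_map (group_atlas G) (group_atlas H) (\<phi> \<circ> ?cG) \<one>\<^bsub>G\<^esub> X
      = tangent_map (group_atlas G) (group_atlas H) (?cH \<circ> \<phi>) \<one>\<^bsub>G\<^esub> X"
    by (rule tangent_map_cong[OF G.open_charts_group G.manifold_open_carrier G.one_closed]) (simp add: g)
  ultimately show ?thesis by simp
qed

lemma lie_algebra_map_log_differential:
  assumes M: "open_charts M" and k: "differentiable_map_at M (group_atlas G) k x"
  shows "lie_algebra_map G H \<phi> (log_differential M G k x v) = log_differential M H (\<phi> \<circ> k) x v"
proof -
  let ?lG = "\<lambda>b. inv\<^bsub>G\<^esub> (k x) \<otimes>\<^bsub>G\<^esub> b" and ?lH = "\<lambda>b. inv\<^bsub>H\<^esub> (\<phi> (k x)) \<otimes>\<^bsub>H\<^esub> b"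
  have c: "k x \<in> carrier G" using differentiable_map_at_points[OF k] G.points_carrier by simp
  have dG: "differentiable_map_at (group_atlas G) (group_atlas G) ?lG (k x)"
    using c by (intro G.differentiable_left_translation) simp_all
  have dH: "differentiable_map_at (group_atlas H) (group_atlas H) ?lH (\<phi> (k x))"
    using c by (intro H.differentiable_left_translation) simp_all
  have 1: "?lG (k x) = \<one>\<^bsub>G\<^esub>" using c by simp
  let ?w = "tangent_map M (group_atlas G) k x v"
  have "lie_algebra_map G H \<phi> (log_differential M G k x v)
      = tangent_map (group_atlas G) (group_atlas H) (\<phi> \<circ> ?lG) (k x) ?w"
    unfolding lie_algebra_map_def log_differential_def
    using tangent_map_comp[OF G.open_charts_group G.open_charts_group dG, unfolded 1,
        OF differentiable_hom[OF G.one_closed], symmetric] .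
  also have "\<dots> = tangent_map (group_atlas G) (group_atlas H) (?lH \<circ> \<phi>) (k x) ?w"
    by (rule tangent_map_cong[OF G.open_charts_group G.manifold_open_carrier c]) (simp add: c)
  also have "\<dots> = tangent_map (group_atlas H) (group_atlas H) ?lH (\<phi> (k x))
      (tangent_map (group_atlas G) (group_atlas H) \<phi> (k x) ?w)"
    by (rule tangent_map_comp[OF G.open_charts_group H.open_charts_group differentiable_hom[OF c] dH])
  also have "\<dots> = log_differential M H (\<phi> \<circ> k) x v"
    unfolding log_differential_def
    by (simp add: tangent_map_comp[OF M G.open_charts_group k differentiable_hom[OF c]])
  finally show ?thesis .
qed

end


section \<open>Connection forms\<close>

lemma chart_tangent_component:
  assumes u: "u \<in> tangent_space M p" and c: "c \<in> charts_at M p"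
  shows "chart_tangent M c p (u c) = u"
proof
  fix k
  show "chart_tangent M c p (u c) k = u k"
  proof (cases "k \<in> charts_at M p")
    case True
    then have "u k = frechet_derivative (transition c k) (at (snd c p)) (u c)"
      using u c unfolding tangent_space_def by blast
    then show ?thesis by (simp only: chart_tangent_def if_True True)
  next
    case False
    then have "u k = 0" using u unfolding tangent_space_def by blast
    then show ?thesis using False by (simp add: chart_tangent_def)
  qed
qed

text \<open>
  The definition of a smooth form gives additivity only for the components in charts around the
  unit. The components in all other charts vanish, since the values lie in the Lie algebra.
\<close>

lemma smooth_lie_form_add:
  assumes M: "banach_manifold M" and \<omega>: "smooth_lie_form M G \<omega>" and p: "p \<in> points M"
    and u: "u \<in> tangent_space M p" and w: "w \<in> tangent_space M p"
  shows "\<omega> p (u + w) = \<omega> p u + \<omega> p w"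
proof
  fix k
  note oM = banach_manifold_open_charts[OF M]
  note uw = tangent_space_add[OF M p u w]
  have val: "\<omega> p t \<in> lie_algebra G" if "t \<in> tangent_space M p" for t
    using \<omega> p that unfolding smooth_lie_form_def by blast
  show "\<omega> p (u + w) k = (\<omega> p u + \<omega> p w) k"
  proof (cases "k \<in> charts_at (group_atlas G) \<one>\<^bsub>G\<^esub>")
    case True
    let ?c = "SOME c. c \<in> charts_at M p"
    have c: "?c \<in> charts_at M p" by (rule some_chart_at[OF p])
    have "\<forall>y\<in>snd ?c ` fst ?c. bounded_linear (form_rep M ?c k \<omega> y)"
      using \<omega> True charts_atD(1)[OF c] unfolding smooth_lie_form_def by blast
    then have lin: "bounded_linear (form_rep M ?c k \<omega> (snd ?c p))"
      using charts_atD(2)[OF c] by blast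
    have rep: "\<omega> p t k = form_rep M ?c k \<omega> (snd ?c p) (t ?c)" if "t \<in> tangent_space M p" for t
      by (simp add: form_rep_def chart_inv_chart_at[OF oM c] chart_tangent_component[OF that c])
    show ?thesis
      using bounded_linear.linear[OF lin] by (simp add: rep u w uw linear_add)
  next
    case False
    have "\<omega> p t k = 0" if "t \<in> tangent_space M p" for t
      using val[OF that] False unfolding lie_algebra_def tangent_space_def by blast
    then show ?thesis by (simp add: u w uw)
  qed
qed

context principal_bundle
begin

lemma open_charts_total: "open_charts P"
  by (rule banach_manifold_open_charts[OF total_manifold])

lemma open_charts_base: "open_charts B"
  by (rule banach_manifold_open_charts[OF base_manifold])

lemma act_closed:
  assumes "p \<in> points P" "g \<in> carrier G"
  shows "act p g \<in> points P"
  using smooth_action assms by (auto simp: smooth_map_on_def)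

lemma differentiable_action:
  assumes "p \<in> points P" "g \<in> carrier G"
  shows "differentiable_map_at (prod_atlas P (group_atlas G)) P (\<lambda>(p, g). act p g) (p, g)"
  by (rule smooth_map_on_differentiable[OF open_charts_prod[OF open_charts_total open_charts_group]
        smooth_action]) (simp add: assms)

lemma differentiable_orbit_map:
  assumes "p \<in> points P" "g \<in> carrier G"
  shows "differentiable_map_at (group_atlas G) P (\<lambda>g. act p g) g"
  using assms points_carrier
    tangent_map_partials(4)[OF open_charts_group total_manifold manifold
      differentiable_map_at_const[OF open_charts_group]
      differentiable_map_at_id[OF manifold], unfolded id_apply, OF _ _ _ differentiable_action]
  by simp

text \<open>
  Every vector tangent to the orbit at \<open>p g\<close> is the value of a fundamental field there, because
  \<open>p b = (p g) (g\<inverse> b)\<close>.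
\<close>

lemma tangent_map_orbit_map:
  assumes p: "p \<in> points P" and g: "g \<in> carrier G"
  shows "tangent_map (group_atlas G) P (\<lambda>b. act p b) g w
    = fundamental_field P act G
        (tangent_map (group_atlas G) (group_atlas G) (\<lambda>b. inv g \<otimes> b) g w) (act p g)"
proof -
  let ?q = "act p g" and ?l = "\<lambda>b. inv g \<otimes> b"
  have q: "?q \<in> points P" by (rule act_closed[OF p g])
  have eq: "act p b = ((\<lambda>b. act ?q b) \<circ> ?l) b" if "b \<in> carrier G" for b
    using that g p by (simp add: act_mult[symmetric] m_assoc[symmetric])
  have l: "differentiable_map_at (group_atlas G) (group_atlas G) ?l g"
    using g by (intro differentiable_left_translation) simp_all
  have 1: "?l g = \<one>" using g by simp
  have "tangent_map (group_atlas G) P (\<lambda>b. act p b) g w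
      = tangent_map (group_atlas G) P ((\<lambda>b. act ?q b) \<circ> ?l) g w"
    by (rule tangent_map_cong[OF open_charts_group manifold_open_carrier g eq])
  also have "\<dots> = fundamental_field P act G (tangent_map (group_atlas G) (group_atlas G) ?l g w) ?q"
    unfolding fundamental_field_def
    using tangent_map_comp[OF open_charts_group open_charts_group l, unfolded 1,
        OF differentiable_orbit_map[OF q one_closed]] .
  finally show ?thesis .
qed

text \<open>The Leibniz rule for the product of a bundle-valued and a group-valued map.\<close>

lemma tangent_map_action:
  assumes M: "open_charts M"
    and \<sigma>: "differentiable_map_at M P \<sigma> x" and k: "differentiable_map_at M (group_atlas G) k x"
  shows "tangent_map M P (\<lambda>y. act (\<sigma> y) (k y)) x v
    = tangent_map P P (\<lambda>p. act p (k x)) (\<sigma> x) (tangent_map M P \<sigma> x v)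
      + fundamental_field P act G (log_differential M G k x v) (act (\<sigma> x) (k x))"
    and "differentiable_map_at P P (\<lambda>p. act p (k x)) (\<sigma> x)"
proof -
  have s: "\<sigma> x \<in> points P" using differentiable_map_at_points[OF \<sigma>] by simp
  have c: "k x \<in> carrier G" using differentiable_map_at_points[OF k] points_carrier by simp
  note part = tangent_map_partials[OF M total_manifold manifold \<sigma> k differentiable_action[OF s c]]
  show "tangent_map M P (\<lambda>y. act (\<sigma> y) (k y)) x v
    = tangent_map P P (\<lambda>p. act p (k x)) (\<sigma> x) (tangent_map M P \<sigma> x v)
      + fundamental_field P act G (log_differential M G k x v) (act (\<sigma> x) (k x))"
    using part(1) by (simp add: tangent_map_orbit_map[OF s c] log_differential_def)
  show "differentiable_map_at P P (\<lambda>p. act p (k x)) (\<sigma> x)" by (rule part(3))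
qed

text \<open>
  The transformation formula that carries the main argument. Besides the Leibniz rule it uses that a
  connection form is equivariant and reproduces the generators of fundamental fields.
\<close>

lemma connection_form_action:
  assumes \<omega>: "connection_form P act G \<omega>" and M: "open_charts M"
    and \<sigma>: "differentiable_map_at M P \<sigma> x" and k: "differentiable_map_at M (group_atlas G) k x"
  shows "\<omega> (act (\<sigma> x) (k x)) (tangent_map M P (\<lambda>y. act (\<sigma> y) (k y)) x v)
    = Ad G (inv (k x)) (\<omega> (\<sigma> x) (tangent_map M P \<sigma> x v)) + log_differential M G k x v"
proof -
  have s: "\<sigma> x \<in> points P" using differentiable_map_at_points[OF \<sigma>] by simp
  have c: "k x \<in> carrier G" using differentiable_map_at_points[OF k] points_carrier by simp
  let ?q = "act (\<sigma> x) (k x)" and ?w = "tangent_map M P \<sigma> x v" and ?X = "log_differential M G k x v"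
  have q: "?q \<in> points P" by (rule act_closed[OF s c])
  have w: "?w \<in> tangent_space P (\<sigma> x)"
    by (rule tangent_map_in_tangent_space[OF M total_manifold \<sigma>])
  have X: "?X \<in> lie_algebra G" by (rule log_differential_in_lie_algebra[OF M k])
  have "tangent_map P P (\<lambda>p. act p (k x)) (\<sigma> x) ?w \<in> tangent_space P ?q"
    by (rule tangent_map_in_tangent_space[OF open_charts_total total_manifold tangent_map_action(2)[OF M \<sigma> k]])
  moreover have "fundamental_field P act G ?X ?q \<in> tangent_space P ?q"
    using tangent_map_in_tangent_space[OF open_charts_group total_manifold
        differentiable_orbit_map[OF q one_closed]]
    by (simp add: fundamental_field_def act_one[OF q])
  ultimately have "\<omega> ?q (tangent_map M P (\<lambda>y. act (\<sigma> y) (k y)) x v)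
      = \<omega> ?q (tangent_map P P (\<lambda>p. act p (k x)) (\<sigma> x) ?w) + \<omega> ?q (fundamental_field P act G ?X ?q)"
    using \<omega> unfolding tangent_map_action(1)[OF M \<sigma> k] connection_form_def
    by (intro smooth_lie_form_add[where G = G, OF total_manifold _ q]) simp_all
  moreover have "\<omega> ?q (fundamental_field P act G ?X ?q) = ?X"
    using \<omega> X q unfolding connection_form_def by blast
  moreover have "\<omega> ?q (tangent_map P P (\<lambda>p. act p (k x)) (\<sigma> x) ?w) = Ad G (inv (k x)) (\<omega> (\<sigma> x) ?w)"
    using \<omega> c s w unfolding connection_form_def pullback_form_def by blast
  ultimately show ?thesis by simp
qed

end


section \<open>Natural sections\<close>

context principal_bundle
begin

text \<open>The part of the total space over \<open>W\<close>, and the natural section of a trivialization.\<close>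

abbreviation (input) over :: "'b set \<Rightarrow> 'p set" where
  "over W \<equiv> {p \<in> points P. \<pi> p \<in> W}"

abbreviation (input) sec :: "'b set \<Rightarrow> ('p \<Rightarrow> 'b \<times> 'g) \<Rightarrow> 'b \<Rightarrow> 'p" where
  "sec \<equiv> natural_section P G \<pi>"

context
  fixes U \<Phi>
  assumes triv: "local_trivialization P act G B \<pi> U \<Phi>"
begin

lemma trivializationD:
  shows "manifold_open B U" "bij_betw \<Phi> (over U) (U \<times> carrier G)"
    "smooth_map_on P (over U) (prod_atlas B (group_atlas G)) \<Phi>"
    "smooth_map_on (prod_atlas B (group_atlas G)) (U \<times> carrier G) P (inv_into (over U) \<Phi>)"
    "\<And>p. p \<in> over U \<Longrightarrow> fst (\<Phi> p) = \<pi> p"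
    "\<And>p g. p \<in> over U \<Longrightarrow> g \<in> carrier G \<Longrightarrow> \<Phi> (act p g) = (fst (\<Phi> p), snd (\<Phi> p) \<otimes> g)"
  using triv unfolding local_trivialization_def Let_def by blast+

lemma natural_section_trivialization:
  assumes "x \<in> U"
  shows "sec U \<Phi> x \<in> over U" "\<Phi> (sec U \<Phi> x) = (x, \<one>)"
proof -
  have "(x, \<one>) \<in> \<Phi> ` (over U)"
    using trivializationD(2) assms by (auto simp: bij_betw_def)
  then show "sec U \<Phi> x \<in> over U" "\<Phi> (sec U \<Phi> x) = (x, \<one>)"
    unfolding natural_section_def by (rule inv_into_into, rule f_inv_into_f)
qed

lemma natural_section_projection:
  assumes "x \<in> U"
  shows "sec U \<Phi> x \<in> points P" "\<pi> (sec U \<Phi> x) = x"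
  using natural_section_trivialization[OF assms] trivializationD(5)[of "sec U \<Phi> x"] by simp_all

lemma differentiable_natural_section:
  assumes x: "x \<in> U"
  shows "differentiable_map_at B P (sec U \<Phi>) x"
proof -
  note oBG = open_charts_prod[OF open_charts_base open_charts_group]
  have xB: "x \<in> points B" using trivializationD(1) x by (auto simp: manifold_open_def)
  have pair: "differentiable_map_at B (prod_atlas B (group_atlas G)) (\<lambda>x. (id x, \<one>)) x"
    by (intro differentiable_map_at_Pair differentiable_map_at_id differentiable_map_at_const
        base_manifold open_charts_base xB) (simp add: points_carrier)
  have inv: "differentiable_map_at (prod_atlas B (group_atlas G)) P (inv_into (over U) \<Phi>) (id x, \<one>)"
    by (rule smooth_map_on_differentiable[OF oBG trivializationD(4)]) (simp add: x)
  have "sec U \<Phi> = inv_into (over U) \<Phi> \<circ> (\<lambda>x. (id x, \<one>))"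
    by (simp add: fun_eq_iff natural_section_def)
  then show ?thesis
    using differentiable_map_at_comp[OF open_charts_base oBG pair inv] by simp
qed

lemma group_component_carrier:
  assumes "p \<in> over U"
  shows "snd (\<Phi> p) \<in> carrier G"
  using bij_betwE[OF trivializationD(2)] assms by (auto simp: mem_Times_iff)

lemma natural_section_decomposition:
  assumes p: "p \<in> over U"
  shows "p = act (sec U \<Phi> (\<pi> p)) (snd (\<Phi> p))"
proof -
  let ?g = "snd (\<Phi> p)"
  have x: "\<pi> p \<in> U" using p by simp
  note g = group_component_carrier[OF p]
  note sec = natural_section_trivialization[OF x] natural_section_projection[OF x]
  have "act (sec U \<Phi> (\<pi> p)) ?g \<in> over U"
    using act_closed[OF sec(3) g] projection_act[OF sec(3) g] x sec(4) by simp
  moreover have "\<Phi> (act (sec U \<Phi> (\<pi> p)) ?g) = \<Phi> p"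
    using trivializationD(6)[OF sec(1) g] trivializationD(5)[OF p] sec(2) g
    by (simp add: prod_eq_iff)
  ultimately show ?thesis
    using inj_onD[OF bij_betw_imp_inj_on[OF trivializationD(2)] _ p] by simp
qed

lemma differentiable_group_component:
  assumes p: "p \<in> over U"
  shows "differentiable_map_at P (group_atlas G) (\<lambda>p. snd (\<Phi> p)) p"
proof -
  note oBG = open_charts_prod[OF open_charts_base open_charts_group]
  have \<Phi>: "differentiable_map_at P (prod_atlas B (group_atlas G)) \<Phi> p"
    by (rule smooth_map_on_differentiable[OF open_charts_total trivializationD(3) p])
  have "differentiable_map_at (prod_atlas B (group_atlas G)) (group_atlas G) snd (fst (\<Phi> p), snd (\<Phi> p))"
    using differentiable_map_at_points(2)[OF \<Phi>]
    by (intro differentiable_map_at_snd open_charts_base manifold) (auto simp: points_prod_atlas)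
  then show ?thesis
    using differentiable_map_at_comp[OF open_charts_total oBG \<Phi>] by (simp add: o_def)
qed

end

lemma differentiable_projection:
  assumes "p \<in> points P"
  shows "differentiable_map_at P B \<pi> p"
  by (rule smooth_map_on_differentiable[OF open_charts_total smooth_projection assms])

end


section \<open>Related connections and their local forms\<close>

theorem theorem4p1:
  fixes P :: "('p, 'ep::banach) atlas" and Q :: "('q, 'eq::banach) atlas"
    and B :: "('b, 'eb::banach) atlas"
    and G :: "('g, 'eg::banach) charted_group" and H :: "('h, 'eh::banach) charted_group"
    and actP :: "'p \<Rightarrow> 'g \<Rightarrow> 'p" and actQ :: "'q \<Rightarrow> 'h \<Rightarrow> 'q"
    and \<pi>P :: "'p \<Rightarrow> 'b" and \<pi>Q :: "'q \<Rightarrow> 'b"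
    and I :: "'i set" and U :: "'i \<Rightarrow> 'b set"
    and \<Phi> :: "'i \<Rightarrow> 'p \<Rightarrow> 'b \<times> 'g" and \<Psi> :: "'i \<Rightarrow> 'q \<Rightarrow> 'b \<times> 'h"
    and f :: "'p \<Rightarrow> 'q" and \<phi> :: "'g \<Rightarrow> 'h"
    and \<omega> :: "('p, 'ep, 'g, 'eg) lie_form" and \<theta> :: "('q, 'eq, 'h, 'eh) lie_form"
    and h :: "'i \<Rightarrow> 'b \<Rightarrow> 'h"
  assumes "principal_bundle P actP G B \<pi>P"
    and "principal_bundle Q actQ H B \<pi>Q"
    and "(\<Union>\<alpha>\<in>I. U \<alpha>) = points B"
    and "\<And>\<alpha>. \<alpha> \<in> I \<Longrightarrow> local_trivialization P actP G B \<pi>P (U \<alpha>) (\<Phi> \<alpha>)"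
    and "\<And>\<alpha>. \<alpha> \<in> I \<Longrightarrow> local_trivialization Q actQ H B \<pi>Q (U \<alpha>) (\<Psi> \<alpha>)"
    and "principal_bundle_morphism P actP G \<pi>P Q actQ H \<pi>Q f \<phi>"
    and "connection_form P actP G \<omega>"
    and "connection_form Q actQ H \<theta>"
    and "\<And>\<alpha>. \<alpha> \<in> I \<Longrightarrow> smooth_map_on B (U \<alpha>) (group_atlas H) (h \<alpha>)"
    and "\<And>\<alpha> x. \<lbrakk>\<alpha> \<in> I; x \<in> U \<alpha>\<rbrakk> \<Longrightarrow>
           f (natural_section P G \<pi>P (U \<alpha>) (\<Phi> \<alpha>) x)
             = actQ (natural_section Q H \<pi>Q (U \<alpha>) (\<Psi> \<alpha>) x) (h \<alpha> x)"
  shows "related_connections P Q G H f \<phi> \<omega> \<theta> \<longleftrightarrow>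
    (\<forall>\<alpha>\<in>I. \<forall>x\<in>U \<alpha>. \<forall>v\<in>tangent_space B x.
       lie_algebra_map G H \<phi> (local_connection_form P G B \<pi>P (U \<alpha>) (\<Phi> \<alpha>) \<omega> x v)
         = Ad H (inv\<^bsub>H\<^esub> (h \<alpha> x)) (local_connection_form Q H B \<pi>Q (U \<alpha>) (\<Psi> \<alpha>) \<theta> x v)
           + log_differential B H (h \<alpha>) x v)"
proof -
  interpret P: principal_bundle P actP G B \<pi>P by fact
  interpret Q: principal_bundle Q actQ H B \<pi>Q by fact
  note mor = assms(6)[unfolded principal_bundle_morphism_def]
  interpret hom: banach_lie_group_hom G H \<phi>
    using mor by unfold_locales blast
  note cover = assms(3) and trivP = assms(4) and trivQ = assms(5)
    and \<omega> = assms(7) and \<theta> = assms(8) and h = assms(9) and fs = assms(10)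
  define s where "s \<alpha> = natural_section P G \<pi>P (U \<alpha>) (\<Phi> \<alpha>)" for \<alpha>
  define t where "t \<alpha> = natural_section Q H \<pi>Q (U \<alpha>) (\<Psi> \<alpha>)" for \<alpha>
  have df: "differentiable_map_at P Q f p" if "p \<in> points P" for p
    using mor smooth_map_on_differentiable[OF P.open_charts_total _ that] by blast
  have ds: "differentiable_map_at B P (s \<alpha>) x" and dt: "differentiable_map_at B Q (t \<alpha>) x"
    and sx: "s \<alpha> x \<in> points P"
    if "\<alpha> \<in> I" "x \<in> U \<alpha>" for \<alpha> x
    unfolding s_def t_def
    using P.differentiable_natural_section[OF trivP that(2)] Q.differentiable_natural_section[OF trivQ that(2)]
      P.natural_section_projection[OF trivP that(2)] that(1) by blast+
  have f_act: "f (actP p g) = actQ (f p) (\<phi> g)" if "p \<in> points P" "g \<in> carrier G" for p g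
    using mor that by blast
  \<comment> \<open>The right-hand side of the local equation is \<open>\<theta>\<close> on the image of \<open>Ts v\<close>.\<close>
  have local: "Ad H (inv\<^bsub>H\<^esub> (h \<alpha> x)) (local_connection_form Q H B \<pi>Q (U \<alpha>) (\<Psi> \<alpha>) \<theta> x v)
        + log_differential B H (h \<alpha>) x v
      = pullback_form P Q f \<theta> (s \<alpha> x) (tangent_map B P (s \<alpha>) x v)"
    if \<alpha>: "\<alpha> \<in> I" and x: "x \<in> U \<alpha>" for \<alpha> x v
  proof -
    have dh: "differentiable_map_at B (group_atlas H) (h \<alpha>) x"
      by (rule smooth_map_on_differentiable[OF P.open_charts_base h[OF \<alpha>] x])
    have eq: "(f \<circ> s \<alpha>) y = actQ (t \<alpha> y) (h \<alpha> y)" if "y \<in> U \<alpha>" for y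
      using fs[OF \<alpha> that] by (simp add: s_def t_def)
    have "tangent_map P Q f (s \<alpha> x) (tangent_map B P (s \<alpha>) x v) = tangent_map B Q (f \<circ> s \<alpha>) x v"
      by (rule tangent_map_comp[OF P.open_charts_base P.open_charts_total ds[OF \<alpha> x] df[OF sx[OF \<alpha> x]], symmetric])
    also have "\<dots> = tangent_map B Q (\<lambda>y. actQ (t \<alpha> y) (h \<alpha> y)) x v"
      by (rule tangent_map_cong[OF P.open_charts_base P.trivializationD(1)[OF trivP[OF \<alpha>]] x eq])
    finally have "pullback_form P Q f \<theta> (s \<alpha> x) (tangent_map B P (s \<alpha>) x v)
        = \<theta> (actQ (t \<alpha> x) (h \<alpha> x)) (tangent_map B Q (\<lambda>y. actQ (t \<alpha> y) (h \<alpha> y)) x v)"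
      using eq[OF x] by (simp only: pullback_form_def o_apply)
    also have "\<dots> = Ad H (inv\<^bsub>H\<^esub> (h \<alpha> x)) (\<theta> (t \<alpha> x) (tangent_map B Q (t \<alpha>) x v))
        + log_differential B H (h \<alpha>) x v"
      by (rule Q.connection_form_action[OF \<theta> P.open_charts_base dt[OF \<alpha> x] dh])
    finally show ?thesis
      by (simp only: local_connection_form_def pullback_form_def t_def)
  qed
  show ?thesis
  proof
    assume rel: "related_connections P Q G H f \<phi> \<omega> \<theta>"
    show "\<forall>\<alpha>\<in>I. \<forall>x\<in>U \<alpha>. \<forall>v\<in>tangent_space B x.
       lie_algebra_map G H \<phi> (local_connection_form P G B \<pi>P (U \<alpha>) (\<Phi> \<alpha>) \<omega> x v)
         = Ad H (inv\<^bsub>H\<^esub> (h \<alpha> x)) (local_connection_form Q H B \<pi>Q (U \<alpha>) (\<Psi> \<alpha>) \<theta> x v)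
           + log_differential B H (h \<alpha>) x v"
    proof (intro ballI)
      fix \<alpha> x v assume \<alpha>: "\<alpha> \<in> I" and x: "x \<in> U \<alpha>"
      have "tangent_map B P (s \<alpha>) x v \<in> tangent_space P (s \<alpha> x)"
        by (rule tangent_map_in_tangent_space[OF P.open_charts_base P.total_manifold ds[OF \<alpha> x]])
      then have "pullback_form P Q f \<theta> (s \<alpha> x) (tangent_map B P (s \<alpha>) x v)
          = lie_algebra_map G H \<phi> (\<omega> (s \<alpha> x) (tangent_map B P (s \<alpha>) x v))"
        using rel sx[OF \<alpha> x] unfolding related_connections_def by blast
      then show "lie_algebra_map G H \<phi> (local_connection_form P G B \<pi>P (U \<alpha>) (\<Phi> \<alpha>) \<omega> x v)
         = Ad H (inv\<^bsub>H\<^esub> (h \<alpha> x)) (local_connection_form Q H B \<pi>Q (U \<alpha>) (\<Psi> \<alpha>) \<theta> x v)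
           + log_differential B H (h \<alpha>) x v"
        unfolding local[OF \<alpha> x] by (simp add: local_connection_form_def pullback_form_def s_def)
    qed
  next
    assume eq: "\<forall>\<alpha>\<in>I. \<forall>x\<in>U \<alpha>. \<forall>v\<in>tangent_space B x.
       lie_algebra_map G H \<phi> (local_connection_form P G B \<pi>P (U \<alpha>) (\<Phi> \<alpha>) \<omega> x v)
         = Ad H (inv\<^bsub>H\<^esub> (h \<alpha> x)) (local_connection_form Q H B \<pi>Q (U \<alpha>) (\<Psi> \<alpha>) \<theta> x v)
           + log_differential B H (h \<alpha>) x v"
    show "related_connections P Q G H f \<phi> \<omega> \<theta>"
      unfolding related_connections_def
    proof (intro ballI)
      fix p u assume p: "p \<in> points P" and u: "u \<in> tangent_space P p"
      have d\<pi>: "differentiable_map_at P B \<pi>P p" by (rule P.differentiable_projection[OF p])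
      then obtain \<alpha> where \<alpha>: "\<alpha> \<in> I" and x: "\<pi>P p \<in> U \<alpha>"
        using cover differentiable_map_at_points(2)[OF d\<pi>] by blast
      let ?W = "P.over (U \<alpha>)" and ?x = "\<pi>P p" and ?\<gamma> = "\<lambda>p. snd (\<Phi> \<alpha> p)"
      note triv = trivP[OF \<alpha>]
      have pW: "p \<in> ?W" using p x by simp
      have W: "manifold_open P ?W"
        using P.trivializationD(3)[OF triv] by (simp add: smooth_map_on_def)
      have decomp: "q = actP (s \<alpha> (\<pi>P q)) (?\<gamma> q)" if "q \<in> ?W" for q
        unfolding s_def by (rule P.natural_section_decomposition[OF triv that])
      have \<gamma>: "?\<gamma> q \<in> carrier G" if "q \<in> ?W" for q
        by (rule P.group_component_carrier[OF triv that])
      have d\<gamma>: "differentiable_map_at P (group_atlas G) ?\<gamma> p"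
        by (rule P.differentiable_group_component[OF triv pW])
      let ?\<sigma> = "s \<alpha> \<circ> \<pi>P"
      have sp: "?\<sigma> q \<in> points P" if "q \<in> ?W" for q using sx[OF \<alpha>] that by simp
      have d\<sigma>: "differentiable_map_at P P ?\<sigma> p"
        by (rule differentiable_map_at_comp[OF P.open_charts_total P.open_charts_base d\<pi> ds[OF \<alpha> x]])
      let ?v = "tangent_map P B \<pi>P p u"
      let ?w = "tangent_map B P (s \<alpha>) ?x ?v"
      have T\<sigma>: "tangent_map P P ?\<sigma> p u = ?w"
        by (rule tangent_map_comp[OF P.open_charts_total P.open_charts_base d\<pi> ds[OF \<alpha> x]])
      \<comment> \<open>On the neighbourhood \<open>?W\<close> of \<open>p\<close>, the identity of \<open>P\<close> is the product of \<open>s \<circ> \<pi>\<close> and \<open>\<gamma>\<close>.\<close>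
      have "u = tangent_map P P id p u" using tangent_map_id[OF u p] by simp
      also have "\<dots> = tangent_map P P (\<lambda>q. actP (?\<sigma> q) (?\<gamma> q)) p u"
        by (rule tangent_map_cong[OF P.open_charts_total W pW]) (use decomp in auto)
      finally have Tu: "tangent_map P P (\<lambda>q. actP (?\<sigma> q) (?\<gamma> q)) p u = u" by simp
      have \<omega>u: "\<omega> p u = Ad G (inv\<^bsub>G\<^esub> (?\<gamma> p)) (\<omega> (?\<sigma> p) ?w) + log_differential P G ?\<gamma> p u"
        using P.connection_form_action[OF \<omega> P.open_charts_total d\<sigma> d\<gamma>, of u] decomp[OF pW]
        unfolding Tu T\<sigma> by simp
      have df\<sigma>: "differentiable_map_at P Q (f \<circ> ?\<sigma>) p"
        by (rule differentiable_map_at_comp[OF P.open_charts_total P.open_charts_total d\<sigma> df[OF sp[OF pW]]])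
      have d\<phi>\<gamma>: "differentiable_map_at P (group_atlas H) (\<phi> \<circ> ?\<gamma>) p"
        by (rule differentiable_map_at_comp[OF P.open_charts_total P.open_charts_group d\<gamma>
              hom.differentiable_hom[OF \<gamma>[OF pW]]])
      have f_decomp: "f q = actQ ((f \<circ> ?\<sigma>) q) ((\<phi> \<circ> ?\<gamma>) q)" if "q \<in> ?W" for q
        using arg_cong[OF decomp[OF that], of f] f_act[OF sp[OF that] \<gamma>[OF that]] by simp
      have Tf: "tangent_map P Q (\<lambda>q. actQ ((f \<circ> ?\<sigma>) q) ((\<phi> \<circ> ?\<gamma>) q)) p u = tangent_map P Q f p u"
        by (rule tangent_map_cong[OF P.open_charts_total W pW, symmetric]) (rule f_decomp)
      have Tf\<sigma>: "tangent_map P Q (f \<circ> ?\<sigma>) p u = tangent_map P Q f (?\<sigma> p) ?w"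
        unfolding T\<sigma>[symmetric]
        by (rule tangent_map_comp[OF P.open_charts_total P.open_charts_total d\<sigma> df[OF sp[OF pW]]])
      have "pullback_form P Q f \<theta> p u
          = Ad H (inv\<^bsub>H\<^esub> (\<phi> (?\<gamma> p))) (pullback_form P Q f \<theta> (?\<sigma> p) ?w)
            + log_differential P H (\<phi> \<circ> ?\<gamma>) p u"
        using Q.connection_form_action[OF \<theta> P.open_charts_total df\<sigma> d\<phi>\<gamma>, of u]
        unfolding Tf Tf\<sigma> f_decomp[OF pW, symmetric] by (simp only: pullback_form_def o_apply)
      also have "pullback_form P Q f \<theta> (?\<sigma> p) ?w = lie_algebra_map G H \<phi> (\<omega> (?\<sigma> p) ?w)"
      proof -
        have "?v \<in> tangent_space B ?x"
          by (rule tangent_map_in_tangent_space[OF P.open_charts_total P.base_manifold d\<pi>])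
        then have "lie_algebra_map G H \<phi> (local_connection_form P G B \<pi>P (U \<alpha>) (\<Phi> \<alpha>) \<omega> ?x ?v)
            = pullback_form P Q f \<theta> (s \<alpha> ?x) ?w"
          using eq \<alpha> x unfolding local[OF \<alpha> x, symmetric] by blast
        then show ?thesis by (simp add: local_connection_form_def pullback_form_def s_def)
      qed
      also have "Ad H (inv\<^bsub>H\<^esub> (\<phi> (?\<gamma> p))) (lie_algebra_map G H \<phi> (\<omega> (?\<sigma> p) ?w))
            + log_differential P H (\<phi> \<circ> ?\<gamma>) p u = lie_algebra_map G H \<phi> (\<omega> p u)"
        by (simp only: \<omega>u hom.lie_algebra_map_add
            hom.lie_algebra_map_log_differential[OF P.open_charts_total d\<gamma>]
            hom.lie_algebra_map_Ad[OF P.inv_closed[OF \<gamma>[OF pW]]] hom.hom_inv[OF \<gamma>[OF pW]])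
      finally show "pullback_form P Q f \<theta> p u = lie_algebra_map G H \<phi> (\<omega> p u)" .
    qed
  qed
qed

end
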